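(* Let $0\le m\le n$ be integers, let $A$ be an $n$-qubit space and $\delta\in\mathbb R$. Let $G:\{0,1\}^n\to\{0,1\}^{n-m}$ be a random function whose dual random function $G^\perp:\{0,1\}^n\to\{0,1\}^m$ is $\delta$-almost universal$_2$ (equivalently, let $G$ be a $\delta$-almost dual universal$_2$ function). Then for a sub-normalized state $\rho_{X^AB}=\sum_x|\tilde x\rangle\langle\tilde x|_A\otimes\tilde\rho^x_B$, $${\rm E}_G\,Q^{{\rm EC},G}(\rho_{X^AB})={\rm E}_G\,Q^{{\rm DC},G}(\rho_{X^AB})\le(\delta-1)\,{\rm Tr}(\rho)+2^{H_{\rm max}(X^A|B)_\rho-(n-m)}.$$
   Context: All Hilbert spaces are finite-dimensional; logarithms are base 2 (with $2^{-\infty}=0$). A sub-normalized state is a positive semidefinite operator of trace at most 1; $\{|\tilde x\rangle\}_{x\in\{0,1\}^n}$ is the $x$ basis of $A=(\mathbb C^2)^{\otimes n}$, i.e. the product eigenbasis of the Pauli $\sigma_X$'s ($\sigma_X|\tilde x_i\rangle=(-1)^{x_i}|\tilde x_i\rangle$ on each qubit). Duality: linear surjective $f:\{0,1\}^n\to\{0,1\}^m$, $g:\{0,1\}^n\to\{0,1\}^{n-m}$, given by full-rank matrices over $\mathbb F_2$ of sizes $m\times n$ and $(n-m)\times n$, are dual ($f\perp g$) if $fg^T=0$. A random function $F$ is a random variable with values in a finite set of functions, and ${\rm E}_F\,r(F)=\sum_f\Pr[F=f]\,r(f)$. Random functions $F,G$ are dual ($F=G^\perp$, $G=F^\perp$)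 if they are chosen from sets $\{f_1,f_2,\dots\}$ and $\{g_1,g_2,\dots\}$ of the same size with $f_i\perp g_i$ and $\Pr[F=f_i]=\Pr[G=g_i]$ for all $i$. A linear random function $F:\{0,1\}^n\to\{0,1\}^m$ is $\delta$-almost universal$_2$ if $\Pr[F(x)=0]\le2^{-m}\delta$ for all $x\ne0$. A random function is $\delta$-almost dual universal$_2$ if its dual random function is $\delta$-almost universal$_2$. Error correction with quantum side information: given $x$ and $\tilde\rho^x_B$, the receiver computes $s=g(x)$, measures $B$ by a POVM $M^s=\{M^{s,e}\}_{e\in\{0,1\}^n}$, outputs $y=x+e$, and fails if $y\ne0$: $Q^{{\rm EC},g}(\rho_{X^AB})=\min_{\{M^s\}}\sum_x\sum_{e:\,x+e\ne0}{\rm Tr}(\tilde\rho^xM^{g(x),e})$. Data compression with quantum side information: the decoder receives $s=g(x)$ and $\tilde\rho^x_B$, measures $B$ by a POVM $M^s$, outputs $x'=e$, and fails if $x'\ne x$: $Q^{{\rm DC},g}(\rho_{X^AB})=\min_{\{M^s\}}\sum_x\sum_{e\ne x}{\rm Tr}(\tilde\rho^xM^{g(x),e})$. The minima are over all families of POVMs indexed by $s\in\{0,1\}^{n-m}$. $H_{\rm max}(X^A|B)_\rho=\max_{\sigma_B\ge0,{\rm Tr}\sigma=1}\log\big(2^n\,\|\sqrt{\rho_{X^AB}}\sqrt{2^{-n}I_A\otimes\sigma_B}\|_1^2\big)$.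
   Formalization: The formal statement assumes δ ≥ 0; for n ≥ 1 this follows from δ-almost universality, while for n = m = 0 and δ < 0 the condition is vacuous and the claim fails (left side 0, right side δ Tr ρ < 0 when Tr ρ > 0). *)

theory Defs
  imports
    "HOL-Probability.Probability_Mass_Function"
    "HOL-Library.Z2"
    "Jordan_Normal_Form.DL_Rank"
    "Jordan_Normal_Form.Schur_Decomposition"
begin

text \<open>
  Operators on an \<open>N\<close>-dimensional Hilbert space are complex matrices in \<open>carrier_mat N N\<close>.
  Bit strings of length \<open>n\<close> are elements of \<open>carrier_vec n\<close> over the two-element field.
\<close>

subsection \<open>Finite-dimensional operators\<close>

definition mat_tr :: "complex mat \<Rightarrow> complex" where
  "mat_tr A = (\<Sum>i<dim_row A. A $$ (i, i))"

definition mat_sum :: "nat \<Rightarrow> nat \<Rightarrow> ('i \<Rightarrow> complex mat) \<Rightarrow> 'i set \<Rightarrow> complex mat" where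
  "mat_sum nr nc f S = Matrix.mat nr nc (\<lambda>ij. \<Sum>x\<in>S. f x $$ ij)"

text \<open>
  The order on \<^typ>\<open>complex\<close> makes \<open>0 \<le> z\<close> say that \<open>z\<close> is real and nonnegative,
  so the quadratic form condition entails that \<open>A\<close> is Hermitian.
\<close>

definition psd :: "nat \<Rightarrow> complex mat \<Rightarrow> bool" where
  "psd N A \<longleftrightarrow> A \<in> carrier_mat N N \<and> (\<forall>v\<in>carrier_vec N. 0 \<le> (A *\<^sub>v v) \<bullet>c v)"

text \<open>The positive semidefinite square root; meaningful for positive semidefinite \<open>A\<close>,
  for which it exists and is unique.\<close>

definition psd_sqrt :: "complex mat \<Rightarrow> complex mat" where
  "psd_sqrt A = (THE S. psd (dim_row A) S \<and> S * S = A)"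

definition trace_norm :: "complex mat \<Rightarrow> real" where
  "trace_norm A = Re (mat_tr (psd_sqrt (mat_adjoint A * A)))"

definition subnormalized :: "nat \<Rightarrow> complex mat \<Rightarrow> bool" where
  "subnormalized N \<rho> \<longleftrightarrow> psd N \<rho> \<and> Re (mat_tr \<rho>) \<le> 1"

definition density_ops :: "nat \<Rightarrow> complex mat set" where
  "density_ops N = {\<sigma>. psd N \<sigma> \<and> mat_tr \<sigma> = 1}"

definition kron_mat :: "complex mat \<Rightarrow> complex mat \<Rightarrow> complex mat" where
  "kron_mat A B = Matrix.mat (dim_row A * dim_row B) (dim_col A * dim_col B)
     (\<lambda>(i, j). A $$ (i div dim_row B, j div dim_col B) * B $$ (i mod dim_row B, j mod dim_col B))"

definition kron_vec :: "complex Matrix.vec \<Rightarrow> complex Matrix.vec \<Rightarrow> complex Matrix.vec" where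
  "kron_vec u v = Matrix.vec (dim_vec u * dim_vec v)
     (\<lambda>i. vec_index u (i div dim_vec v) * vec_index v (i mod dim_vec v))"

subsection \<open>The x basis and classical-quantum states\<close>

definition pauli_X :: "complex mat" where
  "pauli_X = mat_of_rows_list 2 [[0, 1], [1, 0]]"

definition ket_x_qubit :: "bit \<Rightarrow> complex Matrix.vec" where
  "ket_x_qubit b = vec_of_list [1 / sqrt 2, (if b = 0 then 1 else - 1) / sqrt 2]"

lemma pauli_X_ket_x_qubit:
  "pauli_X *\<^sub>v ket_x_qubit b = (if b = 0 then 1 else - 1) \<cdot>\<^sub>v ket_x_qubit b"
  by (rule eq_vecI)
    (auto simp: pauli_X_def ket_x_qubit_def mat_of_rows_list_def scalar_prod_def
      less_Suc_eq numeral_2_eq_2)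

fun ket_x_list :: "bit list \<Rightarrow> complex Matrix.vec" where
  "ket_x_list [] = vec_of_list [1]"
| "ket_x_list (b # bs) = kron_vec (ket_x_qubit b) (ket_x_list bs)"

definition ket_x :: "bit Matrix.vec \<Rightarrow> complex Matrix.vec" where
  "ket_x x = ket_x_list (list_of_vec x)"

definition ket_bra :: "complex Matrix.vec \<Rightarrow> complex mat" where
  "ket_bra u = Matrix.mat (dim_vec u) (dim_vec u) (\<lambda>(i, j). vec_index u i * cnj (vec_index u j))"

lemma finite_carrier_vec_bit [simp]: "finite (carrier_vec n :: bit Matrix.vec set)"
proof -
  have "(UNIV :: bit set) = {0, 1}"
    using bit_not_zero_iff by blast
  then have "finite (UNIV :: bit set)"
    by (metis finite.emptyI finite.insertI)
  then have "finite {xs :: bit list. set xs \<subseteq> UNIV \<and> length xs = n}"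
    by (rule finite_lists_length_eq)
  moreover have "carrier_vec n \<subseteq> vec_of_list ` {xs :: bit list. set xs \<subseteq> UNIV \<and> length xs = n}"
  proof
    fix v :: "bit Matrix.vec"
    assume "v \<in> carrier_vec n"
    then have "list_of_vec v \<in> {xs. set xs \<subseteq> UNIV \<and> length xs = n}"
      by auto
    then show "v \<in> vec_of_list ` {xs. set xs \<subseteq> UNIV \<and> length xs = n}"
      by (metis (no_types) image_eqI vec_list)
  qed
  ultimately show ?thesis
    by (meson finite_imageI finite_subset)
qed

text \<open>\<open>d\<close> is the dimension of \<open>B\<close>, and \<open>\<rho>x x\<close> is the operator of \<open>B\<close> attached to \<open>x\<close>.\<close>

definition cq_state :: "nat \<Rightarrow> nat \<Rightarrow> (bit Matrix.vec \<Rightarrow> complex mat) \<Rightarrow> complex mat" where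
  "cq_state n d \<rho>x = mat_sum (2 ^ n * d) (2 ^ n * d)
     (\<lambda>x. kron_mat (ket_bra (ket_x x)) (\<rho>x x)) (carrier_vec n)"

subsection \<open>Max-entropy\<close>

definition log2_ereal :: "real \<Rightarrow> ereal" where
  "log2_ereal t = (if t > 0 then ereal (log 2 t) else - \<infinity>)"

definition exp2_ereal :: "ereal \<Rightarrow> ereal" where
  "exp2_ereal r = (if r = \<infinity> then \<infinity> else if r = - \<infinity> then 0 else ereal (2 powr real_of_ereal r))"

text \<open>
  The dimension of the first factor \<open>A\<close> is \<open>a\<close>, that of \<open>B\<close> is \<open>d\<close>. The supremum is a
  maximum for \<open>d > 0\<close>, by compactness of the set of density operators.
\<close>

definition H_max :: "nat \<Rightarrow> nat \<Rightarrow> complex mat \<Rightarrow> ereal" where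
  "H_max a d \<rho> = (SUP \<sigma>\<in>density_ops d. log2_ereal (real a *
     (trace_norm (psd_sqrt \<rho> * psd_sqrt (kron_mat ((1 / of_nat a) \<cdot>\<^sub>m 1\<^sub>m a) \<sigma>)))\<^sup>2))"

subsection \<open>Dual random functions\<close>

text \<open>
  Linear functions are represented by their matrices, which determine them uniquely, and
  random functions by their distributions.
\<close>

definition full_rank :: "nat \<Rightarrow> nat \<Rightarrow> bit mat \<Rightarrow> bool" where
  "full_rank k n f \<longleftrightarrow> f \<in> carrier_mat k n \<and> vec_space.rank k f = k"

definition dual_functions :: "nat \<Rightarrow> nat \<Rightarrow> bit mat \<Rightarrow> bit mat \<Rightarrow> bool" where
  "dual_functions n m f g \<longleftrightarrow>
     full_rank m n f \<and> full_rank (n - m) n g \<and> f * transpose_mat g = 0\<^sub>m m (n - m)"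

text \<open>
  The pairing \<open>f\<^sub>i \<leftrightarrow> g\<^sub>i\<close> of the two sets of functions is the bijection \<open>\<phi>\<close>. The sets may
  contain functions of probability zero.
\<close>

definition dual_random_functions :: "nat \<Rightarrow> nat \<Rightarrow> bit mat pmf \<Rightarrow> bit mat pmf \<Rightarrow> bool" where
  "dual_random_functions n m F G \<longleftrightarrow>
     (\<exists>S T \<phi>. finite S \<and> finite T \<and> set_pmf F \<subseteq> S \<and> set_pmf G \<subseteq> T \<and> bij_betw \<phi> S T \<and>
        (\<forall>f\<in>S. dual_functions n m f (\<phi> f) \<and> pmf F f = pmf G (\<phi> f)))"

definition almost_universal2 :: "real \<Rightarrow> nat \<Rightarrow> nat \<Rightarrow> bit mat pmf \<Rightarrow> bool" where
  "almost_universal2 \<delta> n m F \<longleftrightarrow> finite (set_pmf F) \<and> set_pmf F \<subseteq> carrier_mat m n \<and>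
     (\<forall>x\<in>carrier_vec n. x \<noteq> 0\<^sub>v n \<longrightarrow>
        measure_pmf.prob F {f. f *\<^sub>v x = 0\<^sub>v m} \<le> 2 powr (- real m) * \<delta>)"

subsection \<open>Error correction and data compression with quantum side information\<close>

definition povm_family ::
  "nat \<Rightarrow> nat \<Rightarrow> nat \<Rightarrow> (bit Matrix.vec \<Rightarrow> bit Matrix.vec \<Rightarrow> complex mat) \<Rightarrow> bool" where
  "povm_family n k d M \<longleftrightarrow> (\<forall>s\<in>carrier_vec k.
     (\<forall>e\<in>carrier_vec n. psd d (M s e)) \<and> mat_sum d d (M s) (carrier_vec n) = 1\<^sub>m d)"

text \<open>
  In both definitions \<open>g\<close> maps bit strings of length \<open>n\<close> to bit strings of length \<open>k\<close>. The
  infimum is a minimum: the objective is nonnegative, and continuous on the compact set of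
  POVM families.
\<close>

definition Q_EC :: "nat \<Rightarrow> nat \<Rightarrow> nat \<Rightarrow> (bit Matrix.vec \<Rightarrow> bit Matrix.vec) \<Rightarrow>
    (bit Matrix.vec \<Rightarrow> complex mat) \<Rightarrow> real" where
  "Q_EC n k d g \<rho>x = (INF M\<in>{M. povm_family n k d M}.
     \<Sum>x\<in>carrier_vec n. \<Sum>e\<in>{e\<in>carrier_vec n. x + e \<noteq> 0\<^sub>v n}. Re (mat_tr (\<rho>x x * M (g x) e)))"

definition Q_DC :: "nat \<Rightarrow> nat \<Rightarrow> nat \<Rightarrow> (bit Matrix.vec \<Rightarrow> bit Matrix.vec) \<Rightarrow>
    (bit Matrix.vec \<Rightarrow> complex mat) \<Rightarrow> real" where
  "Q_DC n k d g \<rho>x = (INF M\<in>{M. povm_family n k d M}.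
     \<Sum>x\<in>carrier_vec n. \<Sum>e\<in>{e\<in>carrier_vec n. e \<noteq> x}. Re (mat_tr (\<rho>x x * M (g x) e)))"

end

theory Submission
  imports Defs
begin

text \<open>
  Let \<open>r x\<close> be the square root of \<open>\<rho>x x\<close> and \<open>R\<close> the sum of all \<open>r x\<close>. For a fixed \<open>g\<close>, decoding
  each coset of the kernel of \<open>g\<close> with the pretty good measurement of the operators \<open>r x\<close>, rather
  than of the \<open>\<rho>x x\<close>, has failure probability at most the sum of \<open>Tr (r x * r y)\<close> over all pairs
  \<open>x \<noteq> y\<close> with \<open>g x = g y\<close>. By Poisson summation this sum, with the diagonal included, is
  \<open>2 powr - (n - m)\<close> times the sum of the Fourier weights \<open>Tr (R z * R z)\<close>, where \<open>R z\<close> is the Fourier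
  transform of \<open>r\<close> at \<open>z\<close>, over the row space of \<open>g\<close>, which lies in the kernel of the dual
  function \<open>f\<close>. The weight at \<open>0\<close> is \<open>Tr (R * R)\<close>; each other \<open>z\<close> lies in that kernel with
  probability at most \<open>2 powr - m * \<delta>\<close>, and all weights together sum to \<open>2 ^ n * Tr \<rho>\<close>, which
  accounts for the term \<open>\<delta> * Tr \<rho>\<close>. Finally \<open>Tr (R * R)\<close> is at most \<open>2\<close> to the max-entropy, as the
  choice \<open>\<sigma> = R * R / Tr (R * R)\<close> shows.
\<close>

unbundle no vec_syntax

section \<open>Matrices, adjoints and traces\<close>

text \<open>The hypothesis controls only the dual of \<open>G\<close>, so it says nothing directly
  about the probability that two strings collide under \<open>G\<close>; passing to Fourier weights
  moves the average to the dual function, where the bound is available. That step relies on the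
  weights being nonnegative: the overlaps \<open>Tr (r x * r y)\<close> form a Gram kernel, and
  taking square roots normalises its diagonal to add up to exactly \<open>Tr \<rho>\<close>. This
  explains \<open>\<delta> - 1\<close>: diagonal pairs are counted by the Fourier sum but are no
  decoding failures. The failure bound carries no constant factor because it comes from completing a
  square rather than from an operator inequality. The obstacle is that the sum of the
  \<open>r x\<close> on a coset may be singular; it is shifted by a small multiple of the identity,
  and the resulting error, being arbitrarily small, disappears in the infimum over measurements. On
  the entropy side every estimate is a lower bound: one state bounds the supremum, and the real part
  of the trace bounds the trace norm.\<close>

lemma adjoint_carrier [simp, intro]: "A \<in> carrier_mat n k \<Longrightarrow> mat_adjoint A \<in> carrier_mat k n"
  by (auto simp: mat_adjoint_def)

lemma dim_adjoint [simp]: "dim_row (mat_adjoint A) = dim_col A" "dim_col (mat_adjoint A) = dim_row A"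
  by (auto simp: mat_adjoint_def)

lemma index_adjoint [simp]:
  "i < dim_col A \<Longrightarrow> j < dim_row A \<Longrightarrow> mat_adjoint A $$ (i, j) = cnj (A $$ (j, i))"
  by (auto simp: mat_adjoint_def mat_of_rows_def)

lemma adjoint_adjoint [simp]: "mat_adjoint (mat_adjoint A) = (A :: complex mat)"
  by (rule eq_matI) auto

lemma index_mult_sum:
  assumes "A \<in> carrier_mat n k" "B \<in> carrier_mat k l" "i < n" "j < l"
  shows "(A * B) $$ (i, j) = (\<Sum>p<k. A $$ (i, p) * B $$ (p, j))"
  using assms by (auto simp: scalar_prod_def atLeast0LessThan)

lemma adjoint_mult:
  assumes "A \<in> carrier_mat n k" "B \<in> carrier_mat k l"
  shows "mat_adjoint (A * B) = mat_adjoint B * mat_adjoint (A :: complex mat)"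
proof (rule eq_matI)
  fix i j assume "i < dim_row (mat_adjoint B * mat_adjoint A)" "j < dim_col (mat_adjoint B * mat_adjoint A)"
  then have "i < l" "j < n" using assms by auto
  then show "mat_adjoint (A * B) $$ (i, j) = (mat_adjoint B * mat_adjoint A) $$ (i, j)"
    using assms index_mult_sum[OF assms, of j i] index_mult_sum[of "mat_adjoint B" l k "mat_adjoint A" n i j]
    by (auto simp: mult.commute intro!: sum.cong)
qed (use assms in auto)

lemma adjoint_add:
  "A \<in> carrier_mat n k \<Longrightarrow> B \<in> carrier_mat n k \<Longrightarrow>
    mat_adjoint (A + B) = mat_adjoint A + mat_adjoint (B :: complex mat)"
  by (rule eq_matI) auto

lemma adjoint_minus:
  "A \<in> carrier_mat n k \<Longrightarrow> B \<in> carrier_mat n k \<Longrightarrow>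
    mat_adjoint (A - B) = mat_adjoint A - mat_adjoint (B :: complex mat)"
  by (rule eq_matI) auto

lemma adjoint_smult [simp]: "mat_adjoint (c \<cdot>\<^sub>m A) = cnj c \<cdot>\<^sub>m mat_adjoint (A :: complex mat)"
  by (rule eq_matI) auto

lemma adjoint_one [simp]: "mat_adjoint (1\<^sub>m n) = (1\<^sub>m n :: complex mat)"
  by (rule eq_matI) auto

lemma adjoint_zero [simp]: "mat_adjoint (0\<^sub>m n k) = (0\<^sub>m k n :: complex mat)"
  by (rule eq_matI) auto

lemma tr_sum: "A \<in> carrier_mat n n \<Longrightarrow> mat_tr A = (\<Sum>i<n. A $$ (i, i))"
  by (auto simp: mat_tr_def)

lemma tr_mult_sum:
  assumes "A \<in> carrier_mat n k" "B \<in> carrier_mat k n"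
  shows "mat_tr (A * B) = (\<Sum>i<n. \<Sum>j<k. A $$ (i, j) * B $$ (j, i))"
  using assms by (auto simp: mat_tr_def scalar_prod_def atLeast0LessThan)

lemma tr_comm:
  assumes "A \<in> carrier_mat n k" "B \<in> carrier_mat k n"
  shows "mat_tr (A * B) = mat_tr (B * A)"
  unfolding tr_mult_sum[OF assms] tr_mult_sum[OF assms(2,1)]
  by (subst sum.swap) (simp add: mult.commute)

lemma tr_add: "A \<in> carrier_mat n n \<Longrightarrow> B \<in> carrier_mat n n \<Longrightarrow> mat_tr (A + B) = mat_tr A + mat_tr B"
  by (auto simp: mat_tr_def sum.distrib)

lemma tr_minus: "A \<in> carrier_mat n n \<Longrightarrow> B \<in> carrier_mat n n \<Longrightarrow> mat_tr (A - B) = mat_tr A - mat_tr B"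
  by (auto simp: mat_tr_def sum_subtractf)

lemma tr_smult: "A \<in> carrier_mat n n \<Longrightarrow> mat_tr (c \<cdot>\<^sub>m A) = c * mat_tr A"
  by (auto simp: mat_tr_def sum_distrib_left)

lemma tr_adjoint: "A \<in> carrier_mat n n \<Longrightarrow> mat_tr (mat_adjoint A) = cnj (mat_tr A)"
  by (auto simp: mat_tr_def)

lemma tr_adjoint_mult_self:
  assumes "A \<in> carrier_mat n k"
  shows "mat_tr (mat_adjoint A * A) = of_real (\<Sum>i<k. \<Sum>j<n. (cmod (A $$ (j, i)))\<^sup>2)"
  using assms by (subst tr_mult_sum[of _ k n]) (auto simp: complex_norm_square mult.commute simp del: of_real_power)

lemma tr_adjoint_mult_self_eq_0:
  assumes "A \<in> carrier_mat n k" "mat_tr (mat_adjoint A * A) = 0"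
  shows "A = 0\<^sub>m n k"
proof (rule eq_matI)
  have "(\<Sum>i<k. \<Sum>j<n. (cmod (A $$ (j, i)))\<^sup>2) = 0"
    using assms tr_adjoint_mult_self[OF assms(1)] by (metis of_real_eq_0_iff)
  then have "\<forall>i<k. \<forall>j<n. A $$ (j, i) = 0"
    by (auto simp: sum_nonneg_eq_0_iff sum_nonneg)
  then show "A $$ (i, j) = 0\<^sub>m n k $$ (i, j)" if "i < dim_row (0\<^sub>m n k)" "j < dim_col (0\<^sub>m n k)" for i j
    using that by auto
qed (use assms in auto)

lemma mat_sum_carrier [simp, intro]: "mat_sum n k f S \<in> carrier_mat n k"
  by (auto simp: mat_sum_def)

lemma dim_mat_sum [simp]: "dim_row (mat_sum n k f S) = n" "dim_col (mat_sum n k f S) = k"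
  by (auto simp: mat_sum_def)

lemma index_mat_sum [simp]:
  "i < n \<Longrightarrow> j < k \<Longrightarrow> mat_sum n k f S $$ (i, j) = (\<Sum>x\<in>S. f x $$ (i, j))"
  by (auto simp: mat_sum_def)

lemma mat_sum_cong:
  "(\<And>x. x \<in> S \<Longrightarrow> f x = g x) \<Longrightarrow> mat_sum n k f S = mat_sum n k g S"
  by (auto simp: mat_sum_def)

lemma tr_mat_sum:
  assumes "\<And>x. x \<in> S \<Longrightarrow> f x \<in> carrier_mat n n"
  shows "mat_tr (mat_sum n n f S) = (\<Sum>x\<in>S. mat_tr (f x))"
  using assms by (auto simp: tr_sum[of _ n] sum.swap[of _ _ S] intro!: sum.cong)

lemma mat_sum_mult_left:
  assumes "A \<in> carrier_mat l n" "\<And>x. x \<in> S \<Longrightarrow> f x \<in> carrier_mat n k"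
  shows "A * mat_sum n k f S = mat_sum l k (\<lambda>x. A * f x) S"
proof (rule eq_matI)
  fix i j assume "i < dim_row (mat_sum l k (\<lambda>x. A * f x) S)" "j < dim_col (mat_sum l k (\<lambda>x. A * f x) S)"
  then have ij: "i < l" "j < k" by auto
  have "(A * mat_sum n k f S) $$ (i, j) = (\<Sum>p<n. \<Sum>x\<in>S. A $$ (i, p) * f x $$ (p, j))"
    using ij by (simp add: index_mult_sum[OF assms(1) mat_sum_carrier] sum_distrib_left)
  also have "\<dots> = (\<Sum>x\<in>S. (A * f x) $$ (i, j))"
    by (subst sum.swap) (simp add: index_mult_sum[OF assms(1) assms(2) ij] cong: sum.cong)
  finally show "(A * mat_sum n k f S) $$ (i, j) = mat_sum l k (\<lambda>x. A * f x) S $$ (i, j)"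
    using ij by simp
qed (use assms in auto)

lemma adjoint_mat_sum:
  assumes "\<And>x. x \<in> S \<Longrightarrow> f x \<in> carrier_mat n k"
  shows "mat_adjoint (mat_sum n k f S) = mat_sum k n (\<lambda>x. mat_adjoint (f x)) S"
  using assms carrier_matD[OF assms]
  by (intro eq_matI) (auto simp del: carrier_matD intro!: sum.cong)

lemma mat_sum_mult_right:
  assumes "A \<in> carrier_mat k l" "\<And>x. x \<in> S \<Longrightarrow> f x \<in> carrier_mat n k"
  shows "mat_sum n k f S * A = mat_sum n l (\<lambda>x. f x * A) S"
proof (rule eq_matI)
  fix i j assume "i < dim_row (mat_sum n l (\<lambda>x. f x * A) S)" "j < dim_col (mat_sum n l (\<lambda>x. f x * A) S)"
  then have ij: "i < n" "j < l" by auto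
  have "(mat_sum n k f S * A) $$ (i, j) = (\<Sum>p<k. \<Sum>x\<in>S. f x $$ (i, p) * A $$ (p, j))"
    using ij by (simp add: index_mult_sum[OF mat_sum_carrier assms(1)] sum_distrib_right)
  also have "\<dots> = (\<Sum>x\<in>S. (f x * A) $$ (i, j))"
    by (subst sum.swap) (simp add: index_mult_sum[OF assms(2) assms(1) ij] cong: sum.cong)
  finally show "(mat_sum n k f S * A) $$ (i, j) = mat_sum n l (\<lambda>x. f x * A) S $$ (i, j)"
    using ij by simp
qed (use assms in auto)

section \<open>Positive semidefinite matrices and the spectral theorem\<close>

lemma adjoint_inner:
  fixes A :: "complex mat"
  assumes "A \<in> carrier_mat n k" "v \<in> carrier_vec k" "w \<in> carrier_vec n"
  shows "(A *\<^sub>v v) \<bullet>c w = v \<bullet>c (mat_adjoint A *\<^sub>v w)"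
proof -
  have "(A *\<^sub>v v) \<bullet>c w = (\<Sum>i<n. \<Sum>j<k. A $$ (i, j) * v $ j * cnj (w $ i))"
    using assms by (auto simp: scalar_prod_def atLeast0LessThan sum_distrib_right)
  also have "\<dots> = (\<Sum>j<k. \<Sum>i<n. A $$ (i, j) * v $ j * cnj (w $ i))"
    by (rule sum.swap)
  also have "\<dots> = v \<bullet>c (mat_adjoint A *\<^sub>v w)"
    using assms by (auto simp: scalar_prod_def atLeast0LessThan sum_distrib_left mult_ac)
  finally show ?thesis .
qed

lemma inner_self_nonneg: "0 \<le> v \<bullet>c (v :: complex Matrix.vec)"
  by (rule conjugate_square_ge_0_vec)

lemma psdD: "psd n A \<Longrightarrow> v \<in> carrier_vec n \<Longrightarrow> 0 \<le> (A *\<^sub>v v) \<bullet>c v"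
  by (auto simp: psd_def)

lemma psd_carrier: "psd n A \<Longrightarrow> A \<in> carrier_mat n n"
  by (auto simp: psd_def)

lemma psd_adjoint_mult_self:
  assumes "A \<in> carrier_mat n k"
  shows "psd k (mat_adjoint A * A)"
  unfolding psd_def
proof (intro conjI ballI)
  fix v :: "complex Matrix.vec" assume v: "v \<in> carrier_vec k"
  have "((mat_adjoint A * A) *\<^sub>v v) \<bullet>c v = (mat_adjoint A *\<^sub>v (A *\<^sub>v v)) \<bullet>c v"
    using assms v by (simp add: assoc_mult_mat_vec[of _ k n _ k])
  also have "\<dots> = (A *\<^sub>v v) \<bullet>c (A *\<^sub>v v)"
    using adjoint_inner[of "mat_adjoint A" k n "A *\<^sub>v v" v] assms v by simp
  finally show "0 \<le> ((mat_adjoint A * A) *\<^sub>v v) \<bullet>c v"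
    using inner_self_nonneg by simp
qed (use assms in auto)

lemma psd_zero [simp]: "psd n (0\<^sub>m n n)"
  using psd_adjoint_mult_self[of "0\<^sub>m n n" n n] by simp

lemma psd_one [simp]: "psd n (1\<^sub>m n)"
  using psd_adjoint_mult_self[of "1\<^sub>m n" n n] by simp

lemma psd_conj:
  assumes "psd n A" "B \<in> carrier_mat n k"
  shows "psd k (mat_adjoint B * A * B)"
  unfolding psd_def
proof (intro conjI ballI)
  note A = psd_carrier[OF assms(1)]
  fix v :: "complex Matrix.vec" assume v: "v \<in> carrier_vec k"
  have "((mat_adjoint B * A * B) *\<^sub>v v) = (mat_adjoint B *\<^sub>v (A *\<^sub>v (B *\<^sub>v v)))"
    using A assms(2) v mult_carrier_mat[OF adjoint_carrier[OF assms(2)] A]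
    by (simp add: assoc_mult_mat_vec[of _ k n _ k] assoc_mult_mat_vec[of _ k n _ n])
  then have "((mat_adjoint B * A * B) *\<^sub>v v) \<bullet>c v = (A *\<^sub>v (B *\<^sub>v v)) \<bullet>c (B *\<^sub>v v)"
    using adjoint_inner[of "mat_adjoint B" k n "A *\<^sub>v (B *\<^sub>v v)" v] A assms v by simp
  then show "0 \<le> ((mat_adjoint B * A * B) *\<^sub>v v) \<bullet>c v"
    using psdD[OF assms(1), of "B *\<^sub>v v"] assms v by simp
qed (use assms in \<open>auto simp: psd_def\<close>)

lemma psd_add:
  assumes "psd n A" "psd n B"
  shows "psd n (A + B)"
  using assms
  by (auto simp: psd_def add_mult_distrib_mat_vec[of _ n n] add_scalar_prod_distrib[of _ n])

lemma psd_smult: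
  assumes "psd n A" "0 \<le> c"
  shows "psd n (of_real c \<cdot>\<^sub>m A)"
proof -
  have "((of_real c \<cdot>\<^sub>m A) *\<^sub>v v) = of_real c \<cdot>\<^sub>v (A *\<^sub>v v)" if "v \<in> carrier_vec n" for v
    using assms(1) that by (intro eq_vecI) (auto simp: psd_def scalar_prod_def sum_distrib_left mult_ac)
  moreover have "0 \<le> complex_of_real c * z" if "0 \<le> z" for z
    using that assms(2) by (auto simp: less_eq_complex_def)
  ultimately show ?thesis
    using assms by (auto simp: psd_def smult_scalar_prod_distrib[of _ n])
qed

lemma psd_mat_sum:
  assumes "finite S" "\<And>x. x \<in> S \<Longrightarrow> psd n (f x)"
  shows "psd n (mat_sum n n f S)"
  using assms
proof (induction S rule: finite_induct)
  case empty
  have "mat_sum n n f {} = 0\<^sub>m n n" by (rule eq_matI) auto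
  then show ?case by simp
next
  case (insert x S)
  then have "mat_sum n n f (insert x S) = f x + mat_sum n n f S"
    using psd_carrier[of n "f x"] by (intro eq_matI) auto
  then show ?case using insert by (auto intro!: psd_add)
qed

text \<open>Polarisation: the quadratic form is real on \<open>unit_vec n i + c\<close> times
  \<open>unit_vec n j\<close> for every \<open>c\<close>, and two values of \<open>c\<close>
  determine how entry \<open>(i, j)\<close> relates to entry \<open>(j, i)\<close>.\<close>

lemma psd_adjoint:
  assumes "psd n A"
  shows "mat_adjoint A = A"
proof (rule eq_matI)
  note A = psd_carrier[OF assms]
  have real: "Im ((A *\<^sub>v v) \<bullet>c v) = 0" if "v \<in> carrier_vec n" for v
    using psdD[OF assms that] by (auto simp: less_eq_complex_def)
  fix i j assume "i < dim_row A" "j < dim_col A"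
  then have i: "i < n" and j: "j < n" using A by auto
  have entry: "(A *\<^sub>v unit_vec n q) \<bullet>c unit_vec n p = A $$ (p, q)" if "p < n" "q < n" for p q
  proof -
    have "(A *\<^sub>v unit_vec n q) = col A q"
      using A that by (intro eq_vecI) (auto simp: scalar_prod_def unit_vec_def if_distrib cong: if_cong)
    moreover have "conjugate (unit_vec n p) = (unit_vec n p :: complex Matrix.vec)"
      by (intro eq_vecI) (auto simp: unit_vec_def)
    ultimately show ?thesis using A that by simp
  qed
  have "Im (A $$ (i, i)) = 0" "Im (A $$ (j, j)) = 0"
    using entry[OF i i] entry[OF j j] real[of "unit_vec n i"] real[of "unit_vec n j"] by auto
  moreover have "Im (A $$ (i, i) + c * A $$ (i, j) + cnj c * A $$ (j, i) + c * cnj c * A $$ (j, j)) = 0" for c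
  proof -
    let ?v = "unit_vec n i + c \<cdot>\<^sub>v unit_vec n j"
    have "A *\<^sub>v ?v = A *\<^sub>v unit_vec n i + c \<cdot>\<^sub>v (A *\<^sub>v unit_vec n j)"
      using A by (simp add: mult_add_distrib_mat_vec[of A n n] mult_mat_vec[of A n n])
    moreover have "conjugate ?v = conjugate (unit_vec n i) + cnj c \<cdot>\<^sub>v conjugate (unit_vec n j)"
      by (intro eq_vecI) auto
    ultimately have "(A *\<^sub>v ?v) \<bullet>c ?v =
        A $$ (i, i) + c * A $$ (i, j) + cnj c * A $$ (j, i) + c * cnj c * A $$ (j, j)"
      using A by (simp add: entry i j add_scalar_prod_distrib[of _ n] scalar_prod_add_distrib[of _ n]
          smult_scalar_prod_distrib[of _ n] scalar_prod_smult_distrib[of _ n] algebra_simps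
          mult_mat_vec_carrier[of A n n])
    then show ?thesis using real[of ?v] by simp
  qed
  \<comment> \<open>\<open>c = 1\<close> makes the imaginary parts of the two entries opposite, and
    the imaginary unit makes their real parts equal.\<close>
  from this[of 1] this[of \<i>] have "A $$ (i, j) = cnj (A $$ (j, i))"
    using calculation by (auto simp: complex_eq_iff)
  then show "mat_adjoint A $$ (i, j) = A $$ (i, j)"
    using A i j by simp
qed (use psd_carrier[OF assms] in auto)

section \<open>Real diagonal matrices and unitary diagonalisation\<close>

definition real_diag :: "nat \<Rightarrow> (nat \<Rightarrow> real) \<Rightarrow> complex mat" where
  "real_diag n d = Matrix.mat n n (\<lambda>(i, j). if i = j then of_real (d i) else 0)"

lemma real_diag_carrier [simp, intro]: "real_diag n d \<in> carrier_mat n n"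
  by (auto simp: real_diag_def)

lemma dim_real_diag [simp]: "dim_row (real_diag n d) = n" "dim_col (real_diag n d) = n"
  by (auto simp: real_diag_def)

lemma index_real_diag [simp]:
  "i < n \<Longrightarrow> j < n \<Longrightarrow> real_diag n d $$ (i, j) = (if i = j then of_real (d i) else 0)"
  by (auto simp: real_diag_def)

lemma adjoint_real_diag [simp]: "mat_adjoint (real_diag n d) = real_diag n d"
  by (rule eq_matI) auto

lemma index_mult_real_diag:
  assumes "A \<in> carrier_mat k n" "i < k" "j < n"
  shows "(A * real_diag n d) $$ (i, j) = A $$ (i, j) * of_real (d j)"
proof -
  have "(A * real_diag n d) $$ (i, j) = (\<Sum>p<n. A $$ (i, p) * real_diag n d $$ (p, j))"
    by (rule index_mult_sum[OF assms(1) real_diag_carrier assms(2,3)])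
  also have "\<dots> = (\<Sum>p<n. if p = j then A $$ (i, j) * of_real (d j) else 0)"
    using assms by (intro sum.cong) auto
  finally show ?thesis using assms by simp
qed

lemma index_real_diag_mult:
  assumes "A \<in> carrier_mat n k" "i < n" "j < k"
  shows "(real_diag n d * A) $$ (i, j) = of_real (d i) * A $$ (i, j)"
proof -
  have "(real_diag n d * A) $$ (i, j) = (\<Sum>p<n. real_diag n d $$ (i, p) * A $$ (p, j))"
    by (rule index_mult_sum[OF real_diag_carrier assms])
  also have "\<dots> = (\<Sum>p<n. if p = i then of_real (d i) * A $$ (i, j) else 0)"
    using assms by (intro sum.cong) auto
  finally show ?thesis using assms by simp
qed

lemma real_diag_mult: "real_diag n d * real_diag n e = real_diag n (\<lambda>i. d i * e i)"
proof (rule eq_matI)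
  fix i j assume "i < dim_row (real_diag n (\<lambda>i. d i * e i))" "j < dim_col (real_diag n (\<lambda>i. d i * e i))"
  then have "i < n" "j < n" by auto
  then show "(real_diag n d * real_diag n e) $$ (i, j) = real_diag n (\<lambda>i. d i * e i) $$ (i, j)"
    by (subst index_mult_real_diag[of _ n]) auto
qed auto

lemma real_diag_one: "real_diag n (\<lambda>_. 1) = 1\<^sub>m n"
  by (rule eq_matI) auto

lemma adjoint_four_block:
  assumes "A \<in> carrier_mat a a" "B \<in> carrier_mat a b" "C \<in> carrier_mat b a" "D \<in> carrier_mat b b"
  shows "mat_adjoint (four_block_mat A B C D) =
    four_block_mat (mat_adjoint A) (mat_adjoint C) (mat_adjoint B) (mat_adjoint (D :: complex mat))"
  using assms by (intro eq_matI) auto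

lemma block_diag_mult:
  assumes "A \<in> carrier_mat 1 1" "B \<in> carrier_mat 1 1" "X \<in> carrier_mat n n" "Y \<in> carrier_mat n n"
  shows "four_block_mat A (0\<^sub>m 1 n) (0\<^sub>m n 1) X * four_block_mat B (0\<^sub>m 1 n) (0\<^sub>m n 1) Y =
    four_block_mat (A * B) (0\<^sub>m 1 n) (0\<^sub>m n 1) (X * (Y :: complex mat))"
proof -
  have "A * B \<in> carrier_mat 1 1" "X * Y \<in> carrier_mat n n" using assms by auto
  moreover have "0\<^sub>m n 1 * 0\<^sub>m 1 n = (0\<^sub>m n n :: complex mat)" "0\<^sub>m 1 n * 0\<^sub>m n 1 = (0\<^sub>m 1 1 :: complex mat)"
    by (auto intro!: eq_matI)
  ultimately show ?thesis
    using assms mult_four_block_mat[of A 1 1 "0\<^sub>m 1 n" n "0\<^sub>m n 1" n X B 1 "0\<^sub>m 1 n" n "0\<^sub>m n 1" Y] by simp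
qed

text \<open>Gram-Schmidt applied to a basis starting with \<open>v\<close> keeps \<open>v\<close> in
  front. Its output is orthogonal but not normalised, so each column is divided by its norm
  \<open>nr j\<close>; this is why the first column is only a multiple of \<open>v\<close>.\<close>

lemma unitary_first_column:
  fixes v :: "complex Matrix.vec"
  assumes v: "v \<in> carrier_vec n" "v \<noteq> 0\<^sub>v n"
  obtains W c where "W \<in> carrier_mat n n" "mat_adjoint W * W = 1\<^sub>m n" "col W 0 = c \<cdot>\<^sub>v v"
proof -
  interpret cof_vec_space n "TYPE(complex)" .
  define b where "b = basis_completion v"
  define ws where "ws = gram_schmidt n b"
  note bc = basis_completion[OF v, folded b_def]
  have n: "n \<noteq> 0" using v by auto
  obtain vs where bv: "b = v # vs" using bc(6,7) n by (cases b) auto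
  have ws: "set ws \<subseteq> carrier_vec n" "corthogonal ws" "length ws = n"
    using gram_schmidt_result[OF bc(2) bc(4) bc(5) refl, folded ws_def] bc(6) by auto
  have hd: "ws ! 0 = v"
    using gram_schmidt_hd[OF v(1), of vs] ws(3) n hd_conv_nth[of ws]
    by (cases "ws = []") (auto simp: ws_def bv)
  have car: "ws ! i \<in> carrier_vec n" if "i < n" for i using ws that by auto
  define nr where "nr i = sqrt (Re (ws ! i \<bullet>c ws ! i))" for i
  have orth: "ws ! i \<bullet>c ws ! j = (if i = j then of_real ((nr i)\<^sup>2) else 0)" if "i < n" "j < n" for i j
    using corthogonalD[OF ws(2)] ws(3) that inner_self_nonneg[of "ws ! i"]
    by (auto simp: nr_def less_eq_complex_def complex_eq_iff)
  have nr: "nr i \<noteq> 0" if "i < n" for i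
    using orth[OF that that] corthogonalD[OF ws(2), of i i] ws(3) that by auto
  define W where "W = Matrix.mat n n (\<lambda>(i, j). ws ! j $ i / of_real (nr j))"
  have W: "W \<in> carrier_mat n n" by (auto simp: W_def)
  have "mat_adjoint W * W = 1\<^sub>m n"
  proof (rule eq_matI)
    fix i j assume "i < dim_row (1\<^sub>m n :: complex mat)" "j < dim_col (1\<^sub>m n :: complex mat)"
    then have ij: "i < n" "j < n" by auto
    have "(mat_adjoint W * W) $$ (i, j) = (\<Sum>p<n. cnj (ws ! i $ p / of_real (nr i)) * (ws ! j $ p / of_real (nr j)))"
      using W ij by (subst index_mult_sum[of _ n n _ n]) (auto simp: W_def)
    also have "\<dots> = (ws ! j \<bullet>c ws ! i) / of_real (nr i * nr j)"
      using car[of i] car[of j] ij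
      by (auto simp: scalar_prod_def atLeast0LessThan sum_divide_distrib intro!: sum.cong)
    also have "\<dots> = 1\<^sub>m n $$ (i, j)"
      using ij nr[of i] orth[of j i] by (auto simp: power2_eq_square)
    finally show "(mat_adjoint W * W) $$ (i, j) = 1\<^sub>m n $$ (i, j)" .
  qed (use W in auto)
  moreover have "col W 0 = (1 / of_real (nr 0)) \<cdot>\<^sub>v v"
    using n v by (intro eq_vecI) (auto simp: W_def hd)
  ultimately show thesis using that W by blast
qed

text \<open>An eigenvector splits off a one-dimensional block, since the first row of a Hermitian
  matrix vanishes off the diagonal together with its first column.\<close>

theorem hermitian_spectral:
  assumes "A \<in> carrier_mat n n" "mat_adjoint A = A"
  obtains U d where "U \<in> carrier_mat n n" "mat_adjoint U * U = 1\<^sub>m n" "U * mat_adjoint U = 1\<^sub>m n"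
    "A = U * real_diag n d * mat_adjoint U"
proof -
  have "\<exists>U d. U \<in> carrier_mat n n \<and> mat_adjoint U * U = 1\<^sub>m n \<and> mat_adjoint U * A * U = real_diag n d"
    using assms
  proof (induction n arbitrary: A)
    case 0
    show ?case by (rule exI[of _ "1\<^sub>m 0"]) (use 0 in \<open>auto intro!: eq_matI exI[of _ "\<lambda>_. 0"]\<close>)
  next
    case (Suc n)
    note A = Suc.prems(1)
    obtain e where "eigenvalue A e"
    proof -
      have "degree (char_poly A) = Suc n" using degree_monic_char_poly[OF A] by simp
      then have "\<not> constant (poly (char_poly A))" by (simp add: constant_degree)
      then obtain e where "poly (char_poly A) e = 0" using fundamental_theorem_of_algebra by blast
      then show thesis using that eigenvalue_root_char_poly[OF A] by blast
    qed
    then obtain v where v: "v \<in> carrier_vec (Suc n)" "v \<noteq> 0\<^sub>v (Suc n)" "A *\<^sub>v v = e \<cdot>\<^sub>v v"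
      using carrier_matD[OF A] unfolding eigenvalue_def eigenvector_def by metis
    obtain W c where W: "W \<in> carrier_mat (Suc n) (Suc n)" "mat_adjoint W * W = 1\<^sub>m (Suc n)" "col W 0 = c \<cdot>\<^sub>v v"
      using unitary_first_column[OF v(1,2)] .
    have [simp]: "col W 0 \<in> carrier_vec (Suc n)"
      using W(1) by (intro carrier_vecI) auto
    define C where "C = mat_adjoint W * A * W"
    have C: "C \<in> carrier_mat (Suc n) (Suc n)" using A W by (auto simp: C_def)
    have herm: "mat_adjoint C = C"
      using A W Suc.prems(2) unfolding C_def
      by (simp add: adjoint_mult[of _ "Suc n" "Suc n" _ "Suc n"] assoc_mult_mat[of _ "Suc n" "Suc n" _ "Suc n" _ "Suc n"])
    have ev: "A *\<^sub>v col W 0 = e \<cdot>\<^sub>v col W 0"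
      using A v W(3) by (simp add: mult_mat_vec[of A "Suc n" "Suc n"] smult_smult_assoc mult.commute)
    have "col C 0 = e \<cdot>\<^sub>v col (mat_adjoint W * W) 0"
    proof -
      have "col C 0 = (mat_adjoint W * A) *\<^sub>v col W 0"
        unfolding C_def using A W(1) by (subst col_mult2[of _ "Suc n" "Suc n" _ "Suc n"]) auto
      also have "\<dots> = mat_adjoint W *\<^sub>v (A *\<^sub>v col W 0)"
        using A W(1) by (subst assoc_mult_mat_vec[of _ "Suc n" "Suc n" _ "Suc n"]) auto
      also have "\<dots> = e \<cdot>\<^sub>v (mat_adjoint W *\<^sub>v col W 0)"
        unfolding ev using W(1) by (subst mult_mat_vec[of _ "Suc n" "Suc n"]) auto
      also have "mat_adjoint W *\<^sub>v col W 0 = col (mat_adjoint W * W) 0"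
        using W(1) by (subst col_mult2[of _ "Suc n" "Suc n" _ "Suc n"]) auto
      finally show ?thesis .
    qed
    then have "col C 0 $ i = (e \<cdot>\<^sub>v col (mat_adjoint W * W) 0) $ i" for i
      by simp
    then have col0: "C $$ (i, 0) = (if i = 0 then e else 0)" if "i < Suc n" for i
      using that C W(2) by (auto dest: meta_spec[of _ i])
    have row0: "C $$ (0, i) = (if i = 0 then e else 0)" if "i < Suc n" for i
      using that C col0[OF that] index_adjoint[of 0 C i] herm col0[of 0] by (cases "i = 0") auto
    have e: "e = of_real (Re e)"
      using col0[of 0] index_adjoint[of 0 C 0] C herm by (simp add: complex_eq_iff)
    define D where "D = Matrix.mat n n (\<lambda>(i, j). C $$ (Suc i, Suc j))"
    have D: "D \<in> carrier_mat n n" by (auto simp: D_def)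
    have blk: "C = four_block_mat (e \<cdot>\<^sub>m 1\<^sub>m 1) (0\<^sub>m 1 n) (0\<^sub>m n 1) D"
      using C D by (intro eq_matI) (auto simp: col0 row0 D_def)
    have "mat_adjoint D = D"
    proof (rule eq_matI)
      fix i j assume "i < dim_row D" "j < dim_col D"
      then have ij: "i < n" "j < n" using D by auto
      then show "mat_adjoint D $$ (i, j) = D $$ (i, j)"
        using D C herm index_adjoint[of "Suc i" C "Suc j"] by (simp add: D_def)
    qed (use D in auto)
    then obtain V d where V: "V \<in> carrier_mat n n" "mat_adjoint V * V = 1\<^sub>m n" "mat_adjoint V * D * V = real_diag n d"
      using Suc.IH[OF D] by blast
    define X where "X = four_block_mat (1\<^sub>m 1) (0\<^sub>m 1 n) (0\<^sub>m n 1) V"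
    have X: "X \<in> carrier_mat (Suc n) (Suc n)"
      using four_block_carrier_mat[of "1\<^sub>m 1" 1 1 V n n] V by (simp add: X_def)
    have Xa: "mat_adjoint X = four_block_mat (1\<^sub>m 1) (0\<^sub>m 1 n) (0\<^sub>m n 1) (mat_adjoint V)"
      using V unfolding X_def by (subst adjoint_four_block[of _ 1 _ n]) auto
    have XX: "mat_adjoint X * X = 1\<^sub>m (Suc n)"
      unfolding Xa unfolding X_def using V block_diag_mult[of "1\<^sub>m 1" "1\<^sub>m 1" "mat_adjoint V" n V]
      by (simp add: four_block_one_mat)
    have "mat_adjoint X * C = four_block_mat (e \<cdot>\<^sub>m 1\<^sub>m 1) (0\<^sub>m 1 n) (0\<^sub>m n 1) (mat_adjoint V * D)"
      unfolding Xa blk using V D block_diag_mult[of "1\<^sub>m 1" "e \<cdot>\<^sub>m 1\<^sub>m 1" "mat_adjoint V" n D] by simp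
    then have "mat_adjoint X * C * X = four_block_mat (e \<cdot>\<^sub>m 1\<^sub>m 1) (0\<^sub>m 1 n) (0\<^sub>m n 1) (mat_adjoint V * D * V)"
      unfolding X_def using V D mult_carrier_mat[of "mat_adjoint V" n n D n]
        block_diag_mult[of "e \<cdot>\<^sub>m 1\<^sub>m 1" "1\<^sub>m 1" "mat_adjoint V * D" n V] by simp
    also have "\<dots> = real_diag (Suc n) (case_nat (Re e) d)"
      unfolding V(3) using e by (intro eq_matI) (auto split: nat.splits)
    finally have XC: "mat_adjoint X * C * X = real_diag (Suc n) (case_nat (Re e) d)" .
    define U where "U = W * X"
    have U: "U \<in> carrier_mat (Suc n) (Suc n)" using W X by (auto simp: U_def)
    have Ua: "mat_adjoint U = mat_adjoint X * mat_adjoint W"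
      using W X unfolding U_def by (subst adjoint_mult[of _ "Suc n" "Suc n" _ "Suc n"]) auto
    note assoc = assoc_mult_mat[of _ "Suc n" "Suc n" _ "Suc n" _ "Suc n"]
      mult_carrier_mat[of _ "Suc n" "Suc n" _ "Suc n"]
    have "mat_adjoint U * U = mat_adjoint X * (mat_adjoint W * W) * X"
      unfolding Ua using W(1) X unfolding U_def by (simp add: assoc)
    then have "mat_adjoint U * U = 1\<^sub>m (Suc n)" using W(2) X XX by simp
    moreover have "mat_adjoint U * A * U = mat_adjoint X * C * X"
      unfolding Ua C_def using W(1) X A unfolding U_def by (simp add: assoc)
    ultimately show ?case using U XC by metis
  qed
  then obtain U d where U: "U \<in> carrier_mat n n" "mat_adjoint U * U = 1\<^sub>m n" and
    d: "mat_adjoint U * A * U = real_diag n d" by blast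
  have UU: "U * mat_adjoint U = 1\<^sub>m n"
    using mat_mult_left_right_inverse[OF adjoint_carrier[OF U(1)] U(1) U(2)] .
  note assoc = assoc_mult_mat[of _ n n _ n _ n] mult_carrier_mat[of _ n n _ n]
  have "U * real_diag n d * mat_adjoint U = (U * mat_adjoint U) * A * (U * mat_adjoint U)"
    unfolding d[symmetric] using U(1) assms by (simp add: assoc)
  then have "A = U * real_diag n d * mat_adjoint U" using UU assms by simp
  then show thesis using that U UU by blast
qed

section \<open>Square roots and the trace norm\<close>

text \<open>Normalisation rules for words in square matrices of one size. Fixing a single
  \<open>n\<close> for all dimensions lets \<open>simp\<close> discharge the carrier side conditions
  once \<open>n\<close> is instantiated by \<open>[where n=n]\<close>.\<close>

context
  fixes n :: nat
begin

lemmas square_mat_simps = assoc_mult_mat[of _ n n _ n _ n] mult_carrier_mat[of _ n n _ n]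
  add_mult_distrib_mat[of _ n n _ _ n] mult_add_distrib_mat[of _ n n _ n]
  minus_mult_distrib_mat[of _ n n _ _ n] mult_minus_distrib_mat[of _ n n _ n]
  mult_smult_assoc_mat[of _ n n _ n] mult_smult_distrib[of _ n n _ n]
  add_carrier_mat[of _ n n] minus_carrier_mat[of _ n n] smult_carrier_mat[of _ n n]
  adjoint_carrier[of _ n n] adjoint_mult[of _ n n _ n] adjoint_add[of _ n n] adjoint_minus[of _ n n]
  tr_add[of _ n] tr_minus[of _ n] tr_smult[of _ n]

end

lemma psd_diag_nonneg:
  assumes "psd n A" "i < n"
  shows "0 \<le> Re (A $$ (i, i))"
proof -
  note A = psd_carrier[OF assms(1)]
  have "A *\<^sub>v unit_vec n i = col A i"
    using A assms(2) by (intro eq_vecI) (auto simp: scalar_prod_def unit_vec_def if_distrib cong: if_cong)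
  moreover have "conjugate (unit_vec n i) = (unit_vec n i :: complex Matrix.vec)"
    by (intro eq_vecI) (auto simp: unit_vec_def)
  ultimately have "(A *\<^sub>v unit_vec n i) \<bullet>c unit_vec n i = A $$ (i, i)"
    using A assms(2) by simp
  then show ?thesis
    using psdD[OF assms(1), of "unit_vec n i"] by (auto simp: less_eq_complex_def)
qed

lemma psd_tr_nonneg: "psd n A \<Longrightarrow> 0 \<le> Re (mat_tr A)"
  using psd_diag_nonneg[of n A] psd_carrier[of n A] by (auto simp: tr_sum[of _ n] intro!: sum_nonneg)

lemma psd_tr_real: "psd n A \<Longrightarrow> mat_tr A = of_real (Re (mat_tr A))"
  using tr_adjoint[of A n] psd_carrier[of n A] psd_adjoint[of n A] by (simp add: complex_eq_iff)

lemma psd_hermitian_square: "A \<in> carrier_mat n n \<Longrightarrow> mat_adjoint A = A \<Longrightarrow> psd n (A * A)"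
  using psd_adjoint_mult_self[of A n n] by simp

lemma psd_hermitian_conj:
  "psd n A \<Longrightarrow> V \<in> carrier_mat n n \<Longrightarrow> mat_adjoint V = V \<Longrightarrow> psd n (V * A * V)"
  using psd_conj[of n A V n] by simp

lemma psd_spectral:
  assumes "psd n A"
  obtains U d where "U \<in> carrier_mat n n" "mat_adjoint U * U = 1\<^sub>m n" "U * mat_adjoint U = 1\<^sub>m n"
    "A = U * real_diag n d * mat_adjoint U" "\<And>i. i < n \<Longrightarrow> 0 \<le> d i"
proof -
  obtain U d where U: "U \<in> carrier_mat n n" "mat_adjoint U * U = 1\<^sub>m n" "U * mat_adjoint U = 1\<^sub>m n"
    and A: "A = U * real_diag n d * mat_adjoint U"
    using hermitian_spectral[OF psd_carrier psd_adjoint, OF assms assms] by blast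
  have "mat_adjoint U * A * U = (mat_adjoint U * U) * real_diag n d * (mat_adjoint U * U)"
    unfolding A using U(1) by (simp add: square_mat_simps[where n=n])
  then have "psd n (real_diag n d)"
    using psd_conj[OF assms U(1)] U(2) by simp
  then have "0 \<le> d i" if "i < n" for i
    using psd_diag_nonneg that by fastforce
  then show thesis using that U A by blast
qed

lemma psd_real_diag:
  assumes "\<And>i. i < n \<Longrightarrow> 0 \<le> d i"
  shows "psd n (real_diag n d)"
proof -
  have "real_diag n d = mat_adjoint (real_diag n (\<lambda>i. sqrt (d i))) * real_diag n (\<lambda>i. sqrt (d i))"
    unfolding adjoint_real_diag real_diag_mult by (rule eq_matI) (use assms in auto)
  then show ?thesis
    using psd_adjoint_mult_self[of "real_diag n (\<lambda>i. sqrt (d i))" n n] by simp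
qed

lemma psd_root_exists:
  assumes "psd n A"
  obtains S where "psd n S" "S * S = A"
proof -
  obtain U d where U: "U \<in> carrier_mat n n" "mat_adjoint U * U = 1\<^sub>m n"
    and A: "A = U * real_diag n d * mat_adjoint U" and d: "\<And>i. i < n \<Longrightarrow> 0 \<le> d i"
    using psd_spectral[OF assms] by metis
  define E where "E = real_diag n (\<lambda>i. sqrt (d i))"
  have E: "E \<in> carrier_mat n n" by (auto simp: E_def)
  have EE: "E * E = real_diag n d"
    unfolding E_def real_diag_mult by (rule eq_matI) (use d in auto)
  define S where "S = U * E * mat_adjoint U"
  have "psd n S"
    using psd_conj[of n E "mat_adjoint U" n] psd_real_diag[of n "\<lambda>i. sqrt (d i)"] U d
    by (auto simp: S_def E_def)
  moreover have "S * S = U * (E * (mat_adjoint U * U) * E) * mat_adjoint U"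
    using U(1) E by (simp add: S_def square_mat_simps[where n=n])
  then have "S * S = A"
    using U(2) E by (simp add: EE A)
  ultimately show thesis using that by blast
qed

text \<open>By cyclicity the trace equals that of \<open>S * B * S\<close> with \<open>S\<close> the
  root of \<open>A\<close>, and this matrix is again positive semidefinite.\<close>

lemma tr_mult_psd_nonneg:
  assumes "psd n A" "psd n B"
  shows "0 \<le> Re (mat_tr (A * B))"
proof -
  obtain S where S: "psd n S" "S * S = A" using psd_root_exists[OF assms(1)] .
  have c: "S \<in> carrier_mat n n" "B \<in> carrier_mat n n" using S assms psd_carrier by auto
  have "mat_tr (A * B) = mat_tr (S * (S * B))"
    using c by (simp add: S(2)[symmetric] square_mat_simps[where n=n])
  also have "\<dots> = mat_tr (S * B * S)"
    using c by (subst tr_comm[of _ n n]) auto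
  finally show ?thesis
    using psd_tr_nonneg[OF psd_hermitian_conj[OF assms(2) c(1) psd_adjoint[OF S(1)]]] by simp
qed

text \<open>With \<open>Q\<close> the root of \<open>S\<close>, the trace is the squared
  Hilbert-Schmidt norm of \<open>Q * D\<close>; it vanishes only if \<open>Q * D\<close> does, and
  multiplying by \<open>Q\<close> once more gives \<open>S * D\<close>.\<close>

lemma psd_root_annihilates:
  assumes "psd n S" "D \<in> carrier_mat n n" "mat_adjoint D = D" "Re (mat_tr (S * (D * D))) = 0"
  shows "S * D = 0\<^sub>m n n"
proof -
  obtain Q where Q: "psd n Q" "Q * Q = S" using psd_root_exists[OF assms(1)] .
  note c = psd_carrier[OF Q(1)]
  have "mat_tr (mat_adjoint (Q * D) * (Q * D)) = mat_tr (D * (S * D))"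
    using c assms(2,3) psd_adjoint[OF Q(1)] by (simp add: Q(2)[symmetric] square_mat_simps[where n=n])
  also have "\<dots> = mat_tr (S * (D * D))"
    using assms(2) psd_carrier[OF assms(1)] by (subst tr_comm[of _ n n]) (auto simp: square_mat_simps[where n=n])
  finally have "Re (mat_tr (mat_adjoint (Q * D) * (Q * D))) = 0" using assms(4) by simp
  moreover have "Q * D \<in> carrier_mat n n" using c assms(2) by simp
  ultimately have "Q * D = 0\<^sub>m n n"
    using tr_adjoint_mult_self[of "Q * D" n n] tr_adjoint_mult_self_eq_0[of "Q * D" n n] by simp
  then have "Q * (Q * D) = 0\<^sub>m n n" using c by simp
  then show ?thesis using c assms(2) by (simp add: Q(2)[symmetric] square_mat_simps[where n=n])
qed

text \<open>For \<open>D = S - T\<close>, cyclicity and \<open>S * S = T * T\<close> cancel all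
  terms of \<open>Tr ((S + T) * D * D)\<close>. Both summands are nonnegative, so each is zero,
  which forces \<open>S * D = T * D = 0\<close> and hence \<open>D * D = 0\<close>. Uniqueness is
  what gives the definite description in \<open>psd_sqrt\<close> its meaning.\<close>

lemma psd_root_unique:
  assumes "psd n S" "psd n T" "S * S = T * T"
  shows "S = T"
proof -
  note c = psd_carrier[OF assms(1)] psd_carrier[OF assms(2)]
  define D where "D = S - T"
  have D: "D \<in> carrier_mat n n" "mat_adjoint D = D"
    using c assms(1,2)[THEN psd_adjoint] by (auto simp: D_def adjoint_minus[of _ n n])
  \<comment> \<open>Every cubic word reduces to one of the two values \<open>Tr (S * S * T)\<close>
    and \<open>Tr (S * T * T)\<close>, each of which then occurs with total coefficient
    zero.\<close>
  have *: "mat_tr (S * (D * D)) + mat_tr (T * (D * D)) = 0"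
  proof -
    have 1: "mat_tr (S * (T * S)) = mat_tr (S * (S * T))"
      using c tr_comm[of "S * T" n n S] by (simp add: square_mat_simps[where n=n])
    have 2: "mat_tr (T * (S * T)) = mat_tr (S * (T * T))"
      using c tr_comm[of T n n "S * T"] by (simp add: square_mat_simps[where n=n])
    have 3: "mat_tr (T * (T * S)) = mat_tr (S * (T * T))"
      using c tr_comm[of "T * T" n n S] by (simp add: square_mat_simps[where n=n])
    have 4: "mat_tr (T * (S * S)) = mat_tr (S * (S * T))"
      using c tr_comm[of "T" n n "S * S"] by (simp add: square_mat_simps[where n=n])
    have 5: "mat_tr (S * (S * T)) = mat_tr (T * (T * T))"
      using c arg_cong[OF assms(3), of "\<lambda>X. mat_tr (X * T)"] by (simp add: square_mat_simps[where n=n])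
    have 6: "mat_tr (S * (S * S)) = mat_tr (S * (T * T))"
      using c arg_cong[OF assms(3), of "\<lambda>X. mat_tr (S * X)"] by (simp add: square_mat_simps[where n=n])
    show ?thesis
      using c 1 2 3 4 5 6 by (simp add: D_def square_mat_simps[where n=n])
  qed
  have "0 \<le> Re (mat_tr (S * (D * D)))" "0 \<le> Re (mat_tr (T * (D * D)))"
    using tr_mult_psd_nonneg[OF _ psd_hermitian_square[OF D]] assms by auto
  then have "S * D = 0\<^sub>m n n" "T * D = 0\<^sub>m n n"
    using psd_root_annihilates[OF _ D] assms(1,2) arg_cong[OF *, of Re] by auto
  moreover have "D * D = S * D - T * D"
    using minus_mult_distrib_mat[OF c D(1)] by (simp add: D_def)
  ultimately have "mat_adjoint D * D = 0\<^sub>m n n"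
    using D by simp
  then have "D = 0\<^sub>m n n"
    using tr_adjoint_mult_self_eq_0[OF D(1)] by (auto simp: mat_tr_def)
  then have "(S - T) $$ (i, j) = 0" if "i < n" "j < n" for i j
    using that by (simp add: D_def)
  then have "S $$ (i, j) = T $$ (i, j)" if "i < n" "j < n" for i j
    using c that by simp
  then show ?thesis using c by (intro eq_matI) auto
qed

lemma psd_sqrt_eqI:
  assumes "psd n S" "S * S = A"
  shows "psd_sqrt A = S"
proof -
  have "dim_row A = n" using assms psd_carrier by (metis carrier_matD(1) index_mult_mat(2))
  then show ?thesis
    unfolding psd_sqrt_def by (intro the_equality) (use assms psd_root_unique in auto)
qed

lemma
  assumes "psd n A"
  shows psd_psd_sqrt: "psd n (psd_sqrt A)" and psd_sqrt_mult_self: "psd_sqrt A * psd_sqrt A = A"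
  using psd_root_exists[OF assms] psd_sqrt_eqI by metis+

lemma unitary_conj_tr:
  assumes "U \<in> carrier_mat n n" "U * mat_adjoint U = 1\<^sub>m n" "A \<in> carrier_mat n n"
  shows "mat_tr (mat_adjoint U * A * U) = mat_tr A"
proof -
  have "mat_tr (mat_adjoint U * A * U) = mat_tr (U * mat_adjoint U * A)"
    using assms(1,3) tr_comm[of "mat_adjoint U * A" n n U] by (simp add: square_mat_simps[where n=n])
  then show ?thesis using assms by simp
qed

text \<open>In an eigenbasis of the modulus of \<open>A\<close> the diagonal entries of \<open>A\<close> are bounded by
  the norms of the columns, which are the singular values.\<close>

lemma Re_tr_le_trace_norm:
  assumes "A \<in> carrier_mat n n"
  shows "Re (mat_tr A) \<le> trace_norm A"
proof -
  define P where "P = psd_sqrt (mat_adjoint A * A)"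
  have P: "psd n P" "P * P = mat_adjoint A * A"
    using psd_psd_sqrt psd_sqrt_mult_self psd_adjoint_mult_self[OF assms] by (auto simp: P_def)
  obtain U d where U: "U \<in> carrier_mat n n" "mat_adjoint U * U = 1\<^sub>m n" "U * mat_adjoint U = 1\<^sub>m n"
    and d: "P = U * real_diag n d * mat_adjoint U" "\<And>i. i < n \<Longrightarrow> 0 \<le> d i"
    using psd_spectral[OF P(1)] by metis
  define B where "B = mat_adjoint U * A * U"
  have B: "B \<in> carrier_mat n n" using U(1) assms by (simp add: B_def square_mat_simps[where n=n])
  have "mat_adjoint B * B = mat_adjoint U * mat_adjoint A * (U * mat_adjoint U) * A * U"
    using U(1) assms unfolding B_def by (simp add: square_mat_simps[where n=n])
  also have "\<dots> = mat_adjoint U * (P * P) * U"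
    unfolding P(2) U(3) using U(1) assms by (simp add: square_mat_simps[where n=n])
  also have "\<dots> = (mat_adjoint U * U) * real_diag n d * (mat_adjoint U * U) * real_diag n d * (mat_adjoint U * U)"
    unfolding d(1) using U(1) by (simp add: square_mat_simps[where n=n])
  finally have BB: "mat_adjoint B * B = real_diag n (\<lambda>i. d i * d i)"
    unfolding U(2) by (simp add: real_diag_mult)
  have "Re (B $$ (i, i)) \<le> d i" if i: "i < n" for i
  proof -
    have "(mat_adjoint B * B) $$ (i, i) = (\<Sum>j<n. cnj (B $$ (j, i)) * B $$ (j, i))"
      using B i by (subst index_mult_sum[of _ n n _ n]) auto
    then have "of_real (d i * d i) = (\<Sum>j<n. cnj (B $$ (j, i)) * B $$ (j, i))"
      using i BB by simp
    also have "\<dots> = of_real (\<Sum>j<n. (cmod (B $$ (j, i)))\<^sup>2)"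
      by (auto simp: complex_norm_square mult.commute simp del: of_real_power)
    finally have "(d i)\<^sup>2 = (\<Sum>j<n. (cmod (B $$ (j, i)))\<^sup>2)"
      unfolding of_real_eq_iff power2_eq_square .
    then have "(cmod (B $$ (i, i)))\<^sup>2 \<le> (d i)\<^sup>2"
      using i by (auto intro: member_le_sum)
    then have "cmod (B $$ (i, i)) \<le> d i"
      using d(2)[OF i] by (rule power2_le_imp_le)
    then show ?thesis using complex_Re_le_cmod order_trans by blast
  qed
  then have "Re (mat_tr B) \<le> (\<Sum>i<n. d i)"
    using B by (auto simp: tr_sum[of _ n] intro: sum_mono)
  also have "\<dots> = Re (mat_tr P)"
  proof -
    have "mat_tr P = mat_tr (mat_adjoint U * P * U)"
      using unitary_conj_tr[OF U(1,3) psd_carrier[OF P(1)]] by simp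
    also have "mat_adjoint U * P * U = (mat_adjoint U * U) * real_diag n d * (mat_adjoint U * U)"
      unfolding d(1) using U(1) by (simp add: square_mat_simps[where n=n])
    finally show ?thesis unfolding U(2) by (simp add: tr_sum[of _ n])
  qed
  also have "mat_tr B = mat_tr A"
    unfolding B_def by (rule unitary_conj_tr[OF U(1,3) assms])
  finally show ?thesis by (simp add: trace_norm_def P_def)
qed

text \<open>By symmetry of \<open>a\<close> the ratio \<open>t j / t i\<close> may be averaged with
  its inverse, and a positive number plus its inverse is at least 2.\<close>

lemma sum_symmetric_ratio_ge:
  fixes a :: "nat \<Rightarrow> nat \<Rightarrow> real"
  assumes "\<And>i j. i < n \<Longrightarrow> j < n \<Longrightarrow> a i j = a j i" "\<And>i j. 0 \<le> a i j" "\<And>i. i < n \<Longrightarrow> 0 < t i"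
  shows "(\<Sum>i<n. \<Sum>j<n. a i j) \<le> (\<Sum>i<n. \<Sum>j<n. a i j * (t j / t i))"
proof -
  have swap: "(\<Sum>i<n. \<Sum>j<n. a i j * (t j / t i)) = (\<Sum>i<n. \<Sum>j<n. a i j * (t i / t j))"
    by (subst sum.swap) (simp add: assms(1))
  have "2 * (\<Sum>i<n. \<Sum>j<n. a i j) = (\<Sum>i<n. \<Sum>j<n. a i j * 2)"
    by (simp add: sum_distrib_left mult.commute)
  also have "\<dots> \<le> (\<Sum>i<n. \<Sum>j<n. a i j * (t j / t i + t i / t j))"
  proof (intro sum_mono mult_left_mono)
    fix i j assume "i \<in> {..<n}" "j \<in> {..<n}"
    then have t: "0 < t i" "0 < t j" using assms(3) by auto
    have "0 \<le> (t i - t j)\<^sup>2 / (t i * t j)" using t by simp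
    also have "\<dots> = t j / t i + t i / t j - 2"
      using t by (simp add: field_simps power2_eq_square)
    finally show "2 \<le> t j / t i + t i / t j" by simp
  qed (use assms in auto)
  also have "\<dots> = 2 * (\<Sum>i<n. \<Sum>j<n. a i j * (t j / t i))"
    unfolding distrib_left sum.distrib swap[symmetric] by simp
  finally show ?thesis by simp
qed

text \<open>\<open>T\<close> is the root of the shifted operator and \<open>V\<close> its inverse,
  which exists since \<open>c > 0\<close>. The last property compensates for \<open>T\<close> and
  \<open>r\<close> not commuting: in the eigenbasis of \<open>R\<close> both traces are sums of the
  squared moduli of the entries of \<open>r\<close>, the second one weighted by ratios of
  eigenvalues of \<open>T\<close>.\<close>

lemma psd_shifted_root:
  assumes "psd n R" "0 < c"
  obtains V T where "V \<in> carrier_mat n n" "T \<in> carrier_mat n n" "mat_adjoint V = V" "mat_adjoint T = T"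
    "T * T = R + of_real c \<cdot>\<^sub>m 1\<^sub>m n" "V * T = 1\<^sub>m n" "T * V = 1\<^sub>m n"
    "\<And>r. r \<in> carrier_mat n n \<Longrightarrow> mat_adjoint r = r \<Longrightarrow> Re (mat_tr (r * r)) \<le> Re (mat_tr (V * r * (T * r)))"
proof -
  obtain U d where U: "U \<in> carrier_mat n n" "mat_adjoint U * U = 1\<^sub>m n" "U * mat_adjoint U = 1\<^sub>m n"
    and d: "R = U * real_diag n d * mat_adjoint U" "\<And>i. i < n \<Longrightarrow> 0 \<le> d i"
    using psd_spectral[OF assms(1)] by metis
  define t where "t i = sqrt (d i + c)" for i
  have t: "0 < t i" "t i * t i = d i + c" if "i < n" for i
    using d(2)[OF that] assms(2) by (auto simp: t_def)
  define D where "D = real_diag n t"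
  define D' where "D' = real_diag n (\<lambda>i. 1 / t i)"
  have c: "D \<in> carrier_mat n n" "D' \<in> carrier_mat n n" by (auto simp: D_def D'_def)
  have DD: "D' * D = 1\<^sub>m n" "D * D' = 1\<^sub>m n"
    using t(1) unfolding D_def D'_def real_diag_mult real_diag_one[symmetric] 
    by (auto intro!: eq_matI) (metis less_irrefl nonzero_divide_eq_eq)+
  define T where "T = U * D * mat_adjoint U"
  define V where "V = U * D' * mat_adjoint U"
  have TV: "V \<in> carrier_mat n n" "T \<in> carrier_mat n n" "mat_adjoint V = V" "mat_adjoint T = T"
    using U(1) c by (auto simp: T_def V_def square_mat_simps[where n=n]) (auto simp: D_def D'_def)
  have "V * T = U * (D' * (mat_adjoint U * U) * D) * mat_adjoint U"
    using U(1) c by (simp add: V_def T_def square_mat_simps[where n=n])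
  then have VT: "V * T = 1\<^sub>m n" using U c DD by simp
  have "T * V = U * (D * (mat_adjoint U * U) * D') * mat_adjoint U"
    using U(1) c by (simp add: V_def T_def square_mat_simps[where n=n])
  then have TV1: "T * V = 1\<^sub>m n" using U c DD by simp
  have "T * T = U * (D * (mat_adjoint U * U) * D) * mat_adjoint U"
    using U(1) c by (simp add: V_def T_def square_mat_simps[where n=n])
  also have "D * (mat_adjoint U * U) * D = real_diag n d + of_real c \<cdot>\<^sub>m 1\<^sub>m n"
    unfolding U(2) using c t(2) by (auto simp: D_def real_diag_mult intro!: eq_matI)
  also have "U * (real_diag n d + of_real c \<cdot>\<^sub>m 1\<^sub>m n) * mat_adjoint U = R + of_real c \<cdot>\<^sub>m (U * mat_adjoint U)"
    using U(1) by (simp add: d(1) square_mat_simps[where n=n])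
  finally have TT: "T * T = R + of_real c \<cdot>\<^sub>m 1\<^sub>m n" unfolding U(3) .
  have "Re (mat_tr (r * r)) \<le> Re (mat_tr (V * r * (T * r)))"
    if r: "r \<in> carrier_mat n n" "mat_adjoint r = r" for r
  proof -
    \<comment> \<open>\<open>q\<close> is \<open>r\<close> in the eigenbasis of \<open>R\<close>,
      where \<open>T\<close> and \<open>V\<close> become the diagonal matrices \<open>D\<close> and
      \<open>D'\<close>.\<close>
    define q where "q = mat_adjoint U * r * U"
    have q: "q \<in> carrier_mat n n" using U(1) r by (simp add: q_def square_mat_simps[where n=n])
    have "mat_adjoint q = q" using U(1) r by (simp add: q_def square_mat_simps[where n=n])
    then have qa: "q $$ (j, i) = cnj (q $$ (i, j))" if "i < n" "j < n" for i j
      using q that index_adjoint[of j q i] by simp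
    have "q * q = mat_adjoint U * r * (U * mat_adjoint U) * r * U"
      unfolding q_def using U(1) r by (simp add: square_mat_simps[where n=n])
    then have "q * q = mat_adjoint U * (r * r) * U"
      unfolding U(3) using U(1) r by (simp add: square_mat_simps[where n=n])
    then have "mat_tr (r * r) = mat_tr (q * q)"
      using unitary_conj_tr[OF U(1,3), of "r * r"] r by simp
    also have "\<dots> = of_real (\<Sum>i<n. \<Sum>j<n. (cmod (q $$ (i, j)))\<^sup>2)"
    proof -
      have "q $$ (i, j) * q $$ (j, i) = of_real ((cmod (q $$ (i, j)))\<^sup>2)" if "i < n" "j < n" for i j
        unfolding qa[OF that] complex_norm_square ..
      then show ?thesis by (simp add: tr_mult_sum[OF q q])
    qed
    finally have 1: "Re (mat_tr (r * r)) = (\<Sum>i<n. \<Sum>j<n. (cmod (q $$ (i, j)))\<^sup>2)" by simp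
    have "mat_adjoint U * (V * r * (T * r)) * U =
      (mat_adjoint U * U) * D' * mat_adjoint U * r * U * D * mat_adjoint U * r * U"
      unfolding V_def T_def using U(1) r c by (simp add: square_mat_simps[where n=n])
    then have "mat_adjoint U * (V * r * (T * r)) * U = D' * q * (D * q)"
      unfolding U(2) q_def using U(1) r c by (simp add: square_mat_simps[where n=n])
    then have "mat_tr (V * r * (T * r)) = mat_tr (D' * q * (D * q))"
      using unitary_conj_tr[OF U(1,3), of "V * r * (T * r)"] TV(1,2) r(1) by (simp add: mult_carrier_mat[of _ n n _ n])
    also have "\<dots> = (\<Sum>i<n. \<Sum>j<n. (D' * q) $$ (i, j) * (D * q) $$ (j, i))"
      using c q by (subst tr_mult_sum[of _ n n]) auto
    also have "\<dots> = of_real (\<Sum>i<n. \<Sum>j<n. (cmod (q $$ (i, j)))\<^sup>2 * (t j / t i))"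
    proof -
      have "(D' * q) $$ (i, j) * (D * q) $$ (j, i) = of_real ((cmod (q $$ (i, j)))\<^sup>2 * (t j / t i))"
        if "i < n" "j < n" for i j
        unfolding D_def D'_def index_real_diag_mult[OF q that] index_real_diag_mult[OF q that(2,1)] qa[OF that]
        using complex_norm_square[of "q $$ (i, j)"] by (simp add: field_simps)
      then show ?thesis by simp
    qed
    finally have 2: "Re (mat_tr (V * r * (T * r))) = (\<Sum>i<n. \<Sum>j<n. (cmod (q $$ (i, j)))\<^sup>2 * (t j / t i))"
      by simp
    show ?thesis
      unfolding 1 2
    proof (rule sum_symmetric_ratio_ge)
      show "(cmod (q $$ (i, j)))\<^sup>2 = (cmod (q $$ (j, i)))\<^sup>2" if "i < n" "j < n" for i j
        unfolding qa[OF that] by simp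
    qed (use t(1) in auto)
  qed
  then show thesis using that TV TT VT TV1 by blast
qed

section \<open>Decoding with the pretty good measurement\<close>

lemma tr_mat_sum_mult:
  assumes "\<And>x. x \<in> X \<Longrightarrow> f x \<in> carrier_mat n n" "\<And>y. y \<in> Y \<Longrightarrow> h y \<in> carrier_mat n n"
  shows "mat_tr (mat_sum n n f X * mat_sum n n h Y) = (\<Sum>x\<in>X. \<Sum>y\<in>Y. mat_tr (f x * h y))"
proof -
  have "mat_sum n n f X * mat_sum n n h Y = mat_sum n n (\<lambda>x. f x * mat_sum n n h Y) X"
    by (rule mat_sum_mult_right) (use assms in auto)
  also have "\<dots> = mat_sum n n (\<lambda>x. mat_sum n n (\<lambda>y. f x * h y) Y) X"
    by (intro mat_sum_cong mat_sum_mult_left) (use assms in auto)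
  finally show ?thesis
    using assms by (simp add: tr_mat_sum mult_carrier_mat[of _ n n _ n] cong: sum.cong)
qed

text \<open>With \<open>K = T * T\<close> and \<open>a = V * s * V\<close>, the bound is the expansion of
  \<open>0 \<le> Tr ((K - r) * a * (K - r))\<close>.\<close>

lemma pgm_term_bound:
  assumes VT: "V \<in> carrier_mat n n" "T \<in> carrier_mat n n" "mat_adjoint V = V" "mat_adjoint T = T"
      "V * T = 1\<^sub>m n" "T * V = 1\<^sub>m n"
    and mono: "\<And>r. r \<in> carrier_mat n n \<Longrightarrow> mat_adjoint r = r \<Longrightarrow>
      Re (mat_tr (r * r)) \<le> Re (mat_tr (V * r * (T * r)))"
    and r: "psd n r" and e: "0 \<le> e"
  defines "s \<equiv> r + of_real e \<cdot>\<^sub>m 1\<^sub>m n"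
  shows "2 * Re (mat_tr (r * r)) - Re (mat_tr (T * s * T)) \<le> Re (mat_tr (r * r * (V * s * V)))"
proof -
  have rc: "r \<in> carrier_mat n n" "mat_adjoint r = r" using r psd_carrier psd_adjoint by auto
  have s: "psd n s" unfolding s_def by (intro psd_add psd_smult r e psd_one)
  note sc = psd_carrier[OF s]
  define a where "a = V * s * V"
  have a: "psd n a" unfolding a_def by (rule psd_hermitian_conj[OF s VT(1,3)])
  note ac = psd_carrier[OF a]
  define K where "K = T * T"
  have K: "K \<in> carrier_mat n n" "mat_adjoint K = K"
    using VT by (auto simp: K_def adjoint_mult[of _ n n _ n])
  have KV: "K * V = T" "V * K = T"
    using VT(1,2) VT(5,6) assoc_mult_mat[of T n n T n V n] assoc_mult_mat[of V n n T n T n]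
    by (auto simp: K_def)
  have "0 \<le> Re (mat_tr ((K - r) * a * (K - r)))"
    using K rc by (intro psd_tr_nonneg[of n] psd_hermitian_conj[OF a]) (auto simp: adjoint_minus[of _ n n])
  also have "(K - r) * a * (K - r) = K * a * K - r * a * K - (K * a * r - r * a * r)"
    using K(1) rc(1) ac by (simp add: square_mat_simps[where n=n])
  also have "Re (mat_tr \<dots>) = Re (mat_tr (K * a * K)) - Re (mat_tr (r * a * K))
      - Re (mat_tr (K * a * r)) + Re (mat_tr (r * a * r))"
    using K(1) rc(1) ac by (simp add: square_mat_simps[where n=n])
  also have "K * a * K = (K * V) * s * (V * K)"
    unfolding a_def using K(1) VT(1) sc by (simp add: square_mat_simps[where n=n])
  also have "\<dots> = T * s * T" unfolding KV ..
  also have "mat_tr (r * a * K) = mat_tr (V * r * (T * r)) + of_real e * mat_tr r"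
  proof -
    have "r * a * K = r * (V * s * (V * K))"
      unfolding a_def using K(1) VT(1) sc rc(1) by (simp add: square_mat_simps[where n=n])
    then have "mat_tr (r * a * K) = mat_tr (V * s * T * r)"
      unfolding KV using VT(1,2) sc rc(1) tr_comm[of r n n "V * s * T"] by (simp add: square_mat_simps[where n=n])
    also have "V * s * T * r = V * r * (T * r) + of_real e \<cdot>\<^sub>m (V * T * r)"
      unfolding s_def using VT(1,2) rc(1) by (simp add: square_mat_simps[where n=n])
    also have "mat_tr \<dots> = mat_tr (V * r * (T * r)) + of_real e * mat_tr r"
      unfolding VT(5) using VT(1,2) rc(1) by (simp add: square_mat_simps[where n=n])
    finally show ?thesis .
  qed
  also have "mat_tr (K * a * r) = mat_tr (V * r * (T * r)) + of_real e * mat_tr r"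
  proof -
    have "K * a * r = (K * V) * s * V * r"
      unfolding a_def using K(1) VT(1) sc rc(1) by (simp add: square_mat_simps[where n=n])
    also have "\<dots> = T * r * (V * r) + of_real e \<cdot>\<^sub>m (T * V * r)"
      unfolding s_def KV using VT(1,2) rc(1) by (simp add: square_mat_simps[where n=n])
    also have "mat_tr \<dots> = mat_tr (T * r * (V * r)) + of_real e * mat_tr r"
      unfolding VT(6) using VT(1,2) rc(1) by (simp add: square_mat_simps[where n=n])
    also have "mat_tr (T * r * (V * r)) = mat_tr (V * r * (T * r))"
      using VT(1,2) rc(1) by (intro tr_comm[of _ n n]) (auto simp: mult_carrier_mat[of _ n n _ n])
    finally show ?thesis .
  qed
  also have "mat_tr (r * a * r) = mat_tr (r * r * a)"
    using rc(1) ac tr_comm[of "r * a" n n r] by (simp add: square_mat_simps[where n=n])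
  finally have "2 * (Re (mat_tr (V * r * (T * r))) + e * Re (mat_tr r)) - Re (mat_tr (T * s * T))
      \<le> Re (mat_tr (r * r * a))" by simp
  moreover have "0 \<le> e * Re (mat_tr r)" using e psd_tr_nonneg[OF r] by simp
  ultimately show ?thesis using mono[OF rc] by (simp add: a_def)
qed

text \<open>The pretty good measurement of the operators \<open>r x\<close>, shifted slightly so that their sum
  becomes invertible.\<close>

lemma pretty_good_measurement:
  assumes X: "finite X" "X \<noteq> {}" and r: "\<And>x. x \<in> X \<Longrightarrow> psd n (r x)" and "0 < \<eta>"
  defines "R \<equiv> mat_sum n n r X"
  shows "\<exists>a. (\<forall>x\<in>X. psd n (a x)) \<and> mat_sum n n a X = 1\<^sub>m n \<and>
    2 * (\<Sum>x\<in>X. Re (mat_tr (r x * r x))) - Re (mat_tr (R * R)) - \<eta>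
      \<le> (\<Sum>x\<in>X. Re (mat_tr (r x * r x * a x)))"
proof -
  have R: "psd n R" unfolding R_def by (rule psd_mat_sum[OF X(1) r])
  note Rc = psd_carrier[OF R]
  define t where "t = Re (mat_tr R)"
  have t: "0 \<le> t" using psd_tr_nonneg[OF R] by (simp add: t_def)
  \<comment> \<open>Shifting \<open>R\<close> by \<open>c\<close> raises \<open>Tr (R * R)\<close>
    by \<open>2 * c * t + c * c * n\<close>. Capping \<open>c\<close> at 1 bounds this by
    \<open>c * (2 * t + n)\<close>, which the quotient keeps below \<open>\<eta>\<close>; the
    \<open>+ 1\<close> keeps the denominator positive when \<open>t\<close> and \<open>n\<close> are
    zero.\<close>
  define c where "c = min 1 (\<eta> / (2 * t + real n + 1))"
  have c: "0 < c" "c \<le> 1" using \<open>0 < \<eta>\<close> t by (auto simp: c_def)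
  have "c * (2 * t + real n) \<le> c * (2 * t + real n + 1)"
    using c by (intro mult_left_mono) auto
  also have "\<dots> \<le> \<eta>"
  proof -
    have "c \<le> \<eta> / (2 * t + real n + 1)" unfolding c_def by (rule min.cobounded2)
    then show ?thesis using t by (simp add: pos_le_divide_eq)
  qed
  finally have "c * (2 * t + real n) \<le> \<eta>" .
  moreover have "c * c * real n \<le> c * real n" using c by (intro mult_right_mono) auto
  ultimately have c\<eta>: "2 * c * t + c * c * real n \<le> \<eta>" by (simp add: algebra_simps)
  \<comment> \<open>The total shift \<open>c\<close> is split evenly over the operators, so that the
    \<open>s x\<close> add up to \<open>T * T\<close> and the \<open>a x\<close> to the
    identity.\<close>
  define e where "e = c / real (card X)"
  have N: "0 < real (card X)" using X by (simp add: card_gt_0_iff)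
  have e: "0 \<le> e" "real (card X) * e = c" using c N by (auto simp: e_def)
  obtain V T where VT: "V \<in> carrier_mat n n" "T \<in> carrier_mat n n" "mat_adjoint V = V" "mat_adjoint T = T"
    and TT: "T * T = R + of_real c \<cdot>\<^sub>m 1\<^sub>m n" and inv: "V * T = 1\<^sub>m n" "T * V = 1\<^sub>m n"
    and mono: "\<And>r. r \<in> carrier_mat n n \<Longrightarrow> mat_adjoint r = r \<Longrightarrow>
      Re (mat_tr (r * r)) \<le> Re (mat_tr (V * r * (T * r)))"
    using psd_shifted_root[OF R c(1)] by metis
  define s where "s x = r x + of_real e \<cdot>\<^sub>m 1\<^sub>m n" for x
  have s: "psd n (s x)" if "x \<in> X" for x
    unfolding s_def by (intro psd_add psd_smult r that e psd_one)
  note sc = psd_carrier[OF s]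
  have sum_s: "mat_sum n n s X = T * T"
  proof (rule eq_matI)
    fix i j assume "i < dim_row (T * T)" "j < dim_col (T * T)"
    then have ij: "i < n" "j < n" using VT by auto
    have "(\<Sum>x\<in>X. s x $$ (i, j)) = (\<Sum>x\<in>X. r x $$ (i, j) + of_real e * 1\<^sub>m n $$ (i, j))"
      using psd_carrier[OF r] ij by (intro sum.cong) (auto simp: s_def)
    also have "\<dots> = (\<Sum>x\<in>X. r x $$ (i, j)) + of_real (real (card X) * e) * 1\<^sub>m n $$ (i, j)"
      by (simp add: sum.distrib)
    finally show "mat_sum n n s X $$ (i, j) = (T * T) $$ (i, j)"
      unfolding TT e(2) using ij Rc by (simp add: R_def)
  qed (use VT in auto)
  define a where "a x = V * s x * V" for x
  have "psd n (a x)" if "x \<in> X" for x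
    unfolding a_def by (rule psd_hermitian_conj[OF s[OF that] VT(1,3)])
  moreover have "mat_sum n n a X = 1\<^sub>m n"
  proof -
    have "V * mat_sum n n s X * V = mat_sum n n a X"
      unfolding a_def using VT(1) sc
      by (subst mat_sum_mult_left[of _ n], simp_all) (subst mat_sum_mult_right[of _ n n], simp_all add: mult_carrier_mat[of _ n n _ n])
    moreover have "V * (T * T) * V = (V * T) * (T * V)"
      using VT(1,2) by (simp add: square_mat_simps[where n=n])
    ultimately show ?thesis unfolding sum_s inv by simp
  qed
  moreover have "2 * (\<Sum>x\<in>X. Re (mat_tr (r x * r x))) - Re (mat_tr (R * R)) - \<eta>
      \<le> (\<Sum>x\<in>X. Re (mat_tr (r x * r x * a x)))"
  proof -
    have "T * (T * T) * T = mat_sum n n (\<lambda>x. T * s x * T) X"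
      unfolding sum_s[symmetric] using VT(2) sc
      by (subst mat_sum_mult_left[of _ n], simp_all) (subst mat_sum_mult_right[of _ n n], simp_all add: mult_carrier_mat[of _ n n _ n])
    then have "(\<Sum>x\<in>X. Re (mat_tr (T * s x * T))) = Re (mat_tr (T * (T * T) * T))"
      using VT(2) sc by (simp add: tr_mat_sum mult_carrier_mat[of _ n n _ n])
    also have "T * (T * T) * T = T * T * (T * T)"
      using VT(2) by (simp add: square_mat_simps[where n=n])
    also have "\<dots> = R * R + of_real (2 * c) \<cdot>\<^sub>m R + of_real (c * c) \<cdot>\<^sub>m 1\<^sub>m n"
      unfolding TT using Rc
      by (intro eq_matI) (auto simp: square_mat_simps[where n=n] algebra_simps)
    also have "Re (mat_tr \<dots>) = Re (mat_tr (R * R)) + 2 * c * t + c * c * real n"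
      using Rc by (simp add: square_mat_simps[where n=n] t_def tr_sum[of "1\<^sub>m n" n])
    finally have "(\<Sum>x\<in>X. Re (mat_tr (T * s x * T))) \<le> Re (mat_tr (R * R)) + \<eta>"
      using c\<eta> by simp
    moreover have "(\<Sum>x\<in>X. 2 * Re (mat_tr (r x * r x)) - Re (mat_tr (T * s x * T)))
        \<le> (\<Sum>x\<in>X. Re (mat_tr (r x * r x * a x)))"
      unfolding s_def a_def by (intro sum_mono pgm_term_bound[OF VT inv mono r e(1)])
    ultimately show ?thesis by (simp add: sum_subtractf sum_distrib_left)
  qed
  ultimately show ?thesis by blast
qed

section \<open>Error correction, data compression and their failure probability\<close>

lemma bit_vec_add_eq_0_iff:
  fixes x y :: "bit Matrix.vec"
  assumes "x \<in> carrier_vec n" "y \<in> carrier_vec n"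
  shows "x + y = 0\<^sub>v n \<longleftrightarrow> y = x"
proof -
  have "a + b = 0 \<longleftrightarrow> b = a" for a b :: bit by (cases a; cases b) auto
  then show ?thesis
    using assms by (auto simp: vec_eq_iff)
qed

text \<open>Addition is modulo 2, so the correction \<open>e\<close> succeeds exactly when
  \<open>e = x\<close>; the two objectives agree term by term for the same measurements.\<close>

lemma Q_EC_eq_Q_DC: "Q_EC n k d g \<rho>x = Q_DC n k d g \<rho>x"
  unfolding Q_EC_def Q_DC_def
  by (intro INF_cong sum.cong refl) (auto simp: bit_vec_add_eq_0_iff)

text \<open>Failure is total trace minus success. The measurement for each value of \<open>g\<close>
  has success at least \<open>2 * Tr (r x * r x)\<close> summed over its coset, less the overlaps of
  all pairs in it, so one copy of the diagonal is left to subtract.\<close>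

lemma Q_DC_le:
  assumes r: "\<And>x. x \<in> carrier_vec n \<Longrightarrow> psd d (r x)"
    and g: "\<And>x. x \<in> carrier_vec n \<Longrightarrow> g x \<in> carrier_vec k"
  shows "Q_DC n k d g (\<lambda>x. r x * r x) \<le>
    (\<Sum>x\<in>carrier_vec n. \<Sum>y\<in>carrier_vec n. if g x = g y then Re (mat_tr (r x * r y)) else 0)
    - (\<Sum>x\<in>carrier_vec n. Re (mat_tr (r x * r x)))"
proof (rule field_le_epsilon)
  let ?X = "carrier_vec n :: bit Matrix.vec set" and ?S = "carrier_vec k :: bit Matrix.vec set"
  let ?f = "\<lambda>M. \<Sum>x\<in>?X. \<Sum>e\<in>{e\<in>?X. e \<noteq> x}. Re (mat_tr (r x * r x * M (g x) e))"
  note rc = psd_carrier[OF r]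
  have sq: "psd d (r x * r x)" if "x \<in> ?X" for x
    using psd_hermitian_square[OF rc psd_adjoint[OF r]] that by blast
  fix \<epsilon> :: real assume "0 < \<epsilon>"
  \<comment> \<open>The error \<open>\<epsilon>\<close> is shared equally by the measurements, one
    for each possible value of \<open>g\<close>.\<close>
  define \<eta> where "\<eta> = \<epsilon> / real (card ?S)"
  have "?S \<noteq> {}" using zero_carrier_vec by blast
  then have "0 < real (card ?S)" by (simp add: card_gt_0_iff)
  then have \<eta>: "0 < \<eta>" "real (card ?S) * \<eta> = \<epsilon>" using \<open>0 < \<epsilon>\<close> by (auto simp: \<eta>_def)
  \<comment> \<open>A POVM must have an outcome for every string, so strings outside the coset of
    \<open>s\<close> are kept with operator zero instead of being removed from the index
    set.\<close>
  define q where "q s x = (if g x = s then r x else 0\<^sub>m d d)" for s x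
  define R where "R s = mat_sum d d (q s) ?X" for s
  have q: "psd d (q s x)" if "x \<in> ?X" for s x using r that by (simp add: q_def)
  note qc = psd_carrier[OF q]
  have "\<exists>a. (\<forall>x\<in>?X. psd d (a x)) \<and> mat_sum d d a ?X = 1\<^sub>m d \<and>
    2 * (\<Sum>x\<in>?X. Re (mat_tr (q s x * q s x))) - Re (mat_tr (R s * R s)) - \<eta>
      \<le> (\<Sum>x\<in>?X. Re (mat_tr (q s x * q s x * a x)))" for s
  proof -
    have "?X \<noteq> {}" using zero_carrier_vec by blast
    then show ?thesis
      unfolding R_def by (rule pretty_good_measurement[OF finite_carrier_vec_bit _ q \<eta>(1)])
  qed
  then have "\<forall>s. \<exists>a. (\<forall>x\<in>?X. psd d (a x)) \<and> mat_sum d d a ?X = 1\<^sub>m d \<and>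
    2 * (\<Sum>x\<in>?X. Re (mat_tr (q s x * q s x))) - Re (mat_tr (R s * R s)) - \<eta>
      \<le> (\<Sum>x\<in>?X. Re (mat_tr (q s x * q s x * a x)))" ..
  from choice[OF this] obtain M where *: "\<forall>s. (\<forall>x\<in>?X. psd d (M s x)) \<and> mat_sum d d (M s) ?X = 1\<^sub>m d \<and>
    2 * (\<Sum>x\<in>?X. Re (mat_tr (q s x * q s x))) - Re (mat_tr (R s * R s)) - \<eta>
      \<le> (\<Sum>x\<in>?X. Re (mat_tr (q s x * q s x * M s x)))" ..
  have M: "psd d (M s x)" if "x \<in> ?X" for s x
    using *[rule_format, of s] that by (elim conjE) (rule bspec)
  have M1: "mat_sum d d (M s) ?X = 1\<^sub>m d" for s
    using *[rule_format, of s] by (elim conjE)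
  have bound: "2 * (\<Sum>x\<in>?X. Re (mat_tr (q s x * q s x))) - Re (mat_tr (R s * R s)) - \<eta>
      \<le> (\<Sum>x\<in>?X. Re (mat_tr (q s x * q s x * M s x)))" for s
    using *[rule_format, of s] by (elim conjE)
  note Mc = psd_carrier[OF M]
  have "povm_family n k d M" using M M1 by (auto simp: povm_family_def)
  \<comment> \<open>An infimum of reals lies below its elements only for sets bounded below; here 0
    is a bound, since every term is a trace of a product of positive operators.\<close>
  moreover have "bdd_below (?f ` {M. povm_family n k d M})"
    by (intro bdd_belowI2[where m=0] sum_nonneg tr_mult_psd_nonneg[where n=d])
      (use sq g in \<open>auto simp: povm_family_def\<close>)
  ultimately have "Q_DC n k d g (\<lambda>x. r x * r x) \<le> ?f M"
    unfolding Q_DC_def by (intro cINF_lower) auto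
  also have "?f M = (\<Sum>x\<in>?X. Re (mat_tr (r x * r x))) - (\<Sum>x\<in>?X. Re (mat_tr (r x * r x * M (g x) x)))"
  proof -
    have "(\<Sum>e\<in>{e\<in>?X. e \<noteq> x}. Re (mat_tr (r x * r x * M (g x) e))) =
        Re (mat_tr (r x * r x)) - Re (mat_tr (r x * r x * M (g x) x))" if x: "x \<in> ?X" for x
    proof -
      have "r x * r x = r x * r x * mat_sum d d (M (g x)) ?X"
        unfolding M1 by (rule right_mult_one_mat[OF psd_carrier[OF sq[OF x]], symmetric])
      also have "\<dots> = mat_sum d d (\<lambda>e. r x * r x * M (g x) e) ?X"
        using psd_carrier[OF sq[OF x]] Mc by (intro mat_sum_mult_left) auto
      finally have "mat_tr (r x * r x) = (\<Sum>e\<in>?X. mat_tr (r x * r x * M (g x) e))"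
        using tr_mat_sum[of ?X "\<lambda>e. r x * r x * M (g x) e" d] psd_carrier[OF sq[OF x]] Mc
        by (auto simp: mult_carrier_mat[of _ d d _ d])
      then have "Re (mat_tr (r x * r x)) = (\<Sum>e\<in>?X. Re (mat_tr (r x * r x * M (g x) e)))"
        by simp
      moreover have "{e\<in>?X. e \<noteq> x} = ?X - {x}" by auto
      ultimately show ?thesis using x by (simp add: sum_diff1)
    qed
    then show ?thesis by (simp add: sum_subtractf)
  qed
  also have "(\<Sum>x\<in>?X. Re (mat_tr (r x * r x * M (g x) x))) =
      (\<Sum>s\<in>?S. \<Sum>x\<in>?X. Re (mat_tr (q s x * q s x * M s x)))"
  proof -
    have "(\<Sum>s\<in>?S. Re (mat_tr (q s x * q s x * M s x))) = Re (mat_tr (r x * r x * M (g x) x))"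
      if x: "x \<in> ?X" for x
    proof -
      have "0\<^sub>m d d * M s x = 0\<^sub>m d d" for s by (rule left_mult_zero_mat[OF Mc[OF x]])
      then have "(\<Sum>s\<in>?S. Re (mat_tr (q s x * q s x * M s x))) =
          (\<Sum>s\<in>?S. if s = g x then Re (mat_tr (r x * r x * M (g x) x)) else 0)"
        by (intro sum.cong) (auto simp: q_def mat_tr_def)
      then show ?thesis using g[OF x] by simp
    qed
    then show ?thesis by (subst sum.swap) simp
  qed
  finally have Q: "Q_DC n k d g (\<lambda>x. r x * r x) \<le> (\<Sum>x\<in>?X. Re (mat_tr (r x * r x)))
      - (\<Sum>s\<in>?S. \<Sum>x\<in>?X. Re (mat_tr (q s x * q s x * M s x)))" .
  have "(\<Sum>s\<in>?S. \<Sum>x\<in>?X. Re (mat_tr (q s x * q s x * M s x))) \<ge>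
      (\<Sum>s\<in>?S. 2 * (\<Sum>x\<in>?X. Re (mat_tr (q s x * q s x))) - Re (mat_tr (R s * R s)) - \<eta>)"
    by (intro sum_mono bound)
  also have "(\<Sum>s\<in>?S. 2 * (\<Sum>x\<in>?X. Re (mat_tr (q s x * q s x))) - Re (mat_tr (R s * R s)) - \<eta>) =
      2 * (\<Sum>s\<in>?S. \<Sum>x\<in>?X. Re (mat_tr (q s x * q s x))) - (\<Sum>s\<in>?S. Re (mat_tr (R s * R s))) - \<epsilon>"
    by (simp add: sum_subtractf sum_distrib_left \<eta>(2))
  also have "(\<Sum>s\<in>?S. \<Sum>x\<in>?X. Re (mat_tr (q s x * q s x))) = (\<Sum>x\<in>?X. Re (mat_tr (r x * r x)))"
  proof -
    have "(\<Sum>s\<in>?S. Re (mat_tr (q s x * q s x))) = Re (mat_tr (r x * r x))" if x: "x \<in> ?X" for x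
    proof -
      have "(\<Sum>s\<in>?S. Re (mat_tr (q s x * q s x))) = (\<Sum>s\<in>?S. if s = g x then Re (mat_tr (r x * r x)) else 0)"
        by (intro sum.cong) (auto simp: q_def mat_tr_def)
      then show ?thesis using g[OF x] by simp
    qed
    then show ?thesis by (subst sum.swap) simp
  qed
  also have "(\<Sum>s\<in>?S. Re (mat_tr (R s * R s))) =
      (\<Sum>x\<in>?X. \<Sum>y\<in>?X. if g x = g y then Re (mat_tr (r x * r y)) else 0)"
  proof -
    \<comment> \<open>Both factors are nonzero blocks only for the common value
      \<open>s = g x = g y\<close>, so summing over \<open>s\<close> counts each colliding pair
      once.\<close>
    have "(\<Sum>s\<in>?S. Re (mat_tr (q s x * q s y))) = (if g x = g y then Re (mat_tr (r x * r y)) else 0)"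
      if xy: "x \<in> ?X" "y \<in> ?X" for x y
    proof -
      have "(\<Sum>s\<in>?S. Re (mat_tr (q s x * q s y))) =
          (\<Sum>s\<in>?S. if s = g x then if g x = g y then Re (mat_tr (r x * r y)) else 0 else 0)"
        using rc[OF xy(1)] rc[OF xy(2)] by (intro sum.cong) (auto simp: q_def mat_tr_def)
      then show ?thesis using g[OF xy(1)] by simp
    qed
    then have "(\<Sum>x\<in>?X. \<Sum>y\<in>?X. if g x = g y then Re (mat_tr (r x * r y)) else 0) =
        (\<Sum>x\<in>?X. \<Sum>y\<in>?X. \<Sum>s\<in>?S. Re (mat_tr (q s x * q s y)))"
      by simp
    also have "\<dots> = (\<Sum>s\<in>?S. \<Sum>x\<in>?X. \<Sum>y\<in>?X. Re (mat_tr (q s x * q s y)))"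
      by (subst sum.swap[of _ ?X ?S], subst sum.swap[of _ ?X ?S]) simp
    also have "\<dots> = (\<Sum>s\<in>?S. Re (mat_tr (R s * R s)))"
      unfolding R_def using qc by (simp add: tr_mat_sum_mult)
    finally show ?thesis ..
  qed
  finally show "Q_DC n k d g (\<lambda>x. r x * r x) \<le>
    (\<Sum>x\<in>?X. \<Sum>y\<in>?X. if g x = g y then Re (mat_tr (r x * r y)) else 0)
    - (\<Sum>x\<in>?X. Re (mat_tr (r x * r x))) + \<epsilon>"
    using Q by linarith
qed

section \<open>Classical-quantum states and the max-entropy\<close>

lemma sum_div_mod:
  fixes f :: "nat \<Rightarrow> nat \<Rightarrow> 'a :: comm_monoid_add"
  shows "(\<Sum>i<p * q. f (i div q) (i mod q)) = (\<Sum>a<p. \<Sum>b<q. f a b)"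
proof -
  have lt: "a * q + b < p * q" if "a < p" "b < q" for a b
  proof -
    have "a * q + b < Suc a * q" using that by simp
    also have "\<dots> \<le> p * q" using that by (intro mult_le_mono1) auto
    finally show ?thesis .
  qed
  have "(\<Sum>i<p * q. f (i div q) (i mod q)) = (\<Sum>(a, b)\<in>{..<p} \<times> {..<q}. f a b)"
    by (rule sum.reindex_bij_witness[where i="\<lambda>(a, b). a * q + b" and j="\<lambda>i. (i div q, i mod q)"])
      (auto simp: lt less_mult_imp_div_less intro!: mod_less_divisor gr0I)
  then show ?thesis by (simp add: sum.cartesian_product)
qed

lemma div_mod_less: "i < p * q \<Longrightarrow> i div q < p" "i < p * q \<Longrightarrow> i mod q < (q :: nat)"
  by (auto simp: less_mult_imp_div_less intro!: mod_less_divisor gr0I)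

lemma kron_carrier [intro]:
  "A \<in> carrier_mat p p' \<Longrightarrow> B \<in> carrier_mat q q' \<Longrightarrow> kron_mat A B \<in> carrier_mat (p * q) (p' * q')"
  by (auto simp: kron_mat_def)

lemma dim_kron [simp]:
  "dim_row (kron_mat A B) = dim_row A * dim_row B" "dim_col (kron_mat A B) = dim_col A * dim_col B"
  by (auto simp: kron_mat_def)

lemma index_kron:
  "A \<in> carrier_mat p p' \<Longrightarrow> B \<in> carrier_mat q q' \<Longrightarrow> i < p * q \<Longrightarrow> j < p' * q' \<Longrightarrow>
    kron_mat A B $$ (i, j) = A $$ (i div q, j div q') * B $$ (i mod q, j mod q')"
  by (auto simp: kron_mat_def)

lemma kron_mult:
  assumes "A \<in> carrier_mat p p'" "B \<in> carrier_mat q q'" "C \<in> carrier_mat p' p''" "D \<in> carrier_mat q' q''"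
  shows "kron_mat A B * kron_mat C D = kron_mat (A * C) (B * D)"
proof (rule eq_matI)
  fix i j assume "i < dim_row (kron_mat (A * C) (B * D))" "j < dim_col (kron_mat (A * C) (B * D))"
  then have ij: "i < p * q" "j < p'' * q''" using assms by auto
  note dm = div_mod_less[OF ij(1)] div_mod_less[OF ij(2)]
  have "(kron_mat A B * kron_mat C D) $$ (i, j) =
      (\<Sum>k<p' * q'. (A $$ (i div q, k div q') * B $$ (i mod q, k mod q')) *
        (C $$ (k div q', j div q'') * D $$ (k mod q', j mod q'')))"
    using assms ij index_mult_sum[OF kron_carrier[OF assms(1,2)] kron_carrier[OF assms(3,4)] ij]
    by (auto simp: index_kron[OF assms(1,2)] index_kron[OF assms(3,4)])
  also have "\<dots> = (\<Sum>a<p'. \<Sum>b<q'. (A $$ (i div q, a) * B $$ (i mod q, b)) *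
        (C $$ (a, j div q'') * D $$ (b, j mod q'')))"
    by (rule sum_div_mod)
  also have "\<dots> = (\<Sum>a<p'. A $$ (i div q, a) * C $$ (a, j div q'')) *
      (\<Sum>b<q'. B $$ (i mod q, b) * D $$ (b, j mod q''))"
    by (simp add: sum_product mult_ac)
  also have "\<dots> = kron_mat (A * C) (B * D) $$ (i, j)"
    using assms dm index_mult_sum[OF assms(1,3) dm(1,3)] index_mult_sum[OF assms(2,4) dm(2,4)] ij
    by (simp add: index_kron[of _ p p'' _ q q''] mult_carrier_mat[of _ p p' _ p''] mult_carrier_mat[of _ q q' _ q''])
  finally show "(kron_mat A B * kron_mat C D) $$ (i, j) = kron_mat (A * C) (B * D) $$ (i, j)" .
qed (use assms in auto)

lemma adjoint_kron:
  assumes "A \<in> carrier_mat p p'" "B \<in> carrier_mat q q'"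
  shows "mat_adjoint (kron_mat A B) = kron_mat (mat_adjoint A) (mat_adjoint B)"
proof (rule eq_matI)
  fix i j assume "i < dim_row (kron_mat (mat_adjoint A) (mat_adjoint B))" "j < dim_col (kron_mat (mat_adjoint A) (mat_adjoint B))"
  then have ij: "i < p' * q'" "j < p * q" using assms by auto
  then show "mat_adjoint (kron_mat A B) $$ (i, j) = kron_mat (mat_adjoint A) (mat_adjoint B) $$ (i, j)"
    using assms div_mod_less[OF ij(1)] div_mod_less[OF ij(2)]
    by (auto simp: index_kron[OF assms] index_kron[OF adjoint_carrier adjoint_carrier, OF assms])
qed (use assms in auto)

lemma tr_kron:
  assumes "A \<in> carrier_mat p p" "B \<in> carrier_mat q q"
  shows "mat_tr (kron_mat A B) = mat_tr A * mat_tr B"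
proof -
  have "mat_tr (kron_mat A B) = (\<Sum>i<p * q. A $$ (i div q, i div q) * B $$ (i mod q, i mod q))"
    using assms by (auto simp: tr_sum[OF kron_carrier[OF assms]] index_kron[OF assms])
  also have "\<dots> = (\<Sum>a<p. \<Sum>b<q. A $$ (a, a) * B $$ (b, b))" by (rule sum_div_mod)
  finally show ?thesis using assms by (simp add: tr_sum sum_product)
qed

lemma psd_kron:
  assumes "psd p A" "psd q B"
  shows "psd (p * q) (kron_mat A B)"
proof -
  obtain S where S: "psd p S" "S * S = A" using psd_root_exists[OF assms(1)] .
  obtain T where T: "psd q T" "T * T = B" using psd_root_exists[OF assms(2)] .
  note c = psd_carrier[OF S(1)] psd_carrier[OF T(1)]
  have "kron_mat A B = mat_adjoint (kron_mat S T) * kron_mat S T"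
    using c by (simp add: adjoint_kron psd_adjoint[OF S(1)] psd_adjoint[OF T(1)] kron_mult S(2) T(2))
  then show ?thesis using psd_adjoint_mult_self[OF kron_carrier[OF c]] by simp
qed

lemma kron_zero_left: "B \<in> carrier_mat q q' \<Longrightarrow> kron_mat (0\<^sub>m p p') B = 0\<^sub>m (p * q) (p' * q')"
  by (intro eq_matI) (auto simp: index_kron[OF zero_carrier_mat] div_mod_less)

lemma kron_one_left: "B \<in> carrier_mat q q' \<Longrightarrow> kron_mat (1\<^sub>m 1) B = B"
  by (intro eq_matI) (auto simp: index_kron[OF one_carrier_mat])

text \<open>A ket as a matrix with one column, so that inner products, projectors and Kronecker
  products with operators on \<open>B\<close> all become matrix products.\<close>

definition ket_mat :: "complex Matrix.vec \<Rightarrow> complex mat" where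
  "ket_mat u = Matrix.mat (dim_vec u) 1 (\<lambda>(i, j). u $ i)"

lemma dim_ket_x_list: "dim_vec (ket_x_list bs) = 2 ^ length bs"
  by (induction bs) (auto simp: kron_vec_def ket_x_qubit_def)

lemma dim_ket_x: "x \<in> carrier_vec n \<Longrightarrow> dim_vec (ket_x x) = 2 ^ n"
  by (auto simp: ket_x_def dim_ket_x_list)

lemma ket_mat_carrier: "x \<in> carrier_vec n \<Longrightarrow> ket_mat (ket_x x) \<in> carrier_mat (2 ^ n) 1"
  by (auto simp: ket_mat_def dim_ket_x)

text \<open>Splitting the index by \<open>div\<close> and \<open>mod\<close> factors the inner
  product into that of the first qubit and that of the remaining ones.\<close>

lemma ket_x_list_orthonormal:
  "length bs = length cs \<Longrightarrow>
    (\<Sum>i<2 ^ length bs. cnj (ket_x_list bs $ i) * ket_x_list cs $ i) = (if bs = cs then 1 else 0)"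
proof (induction bs cs rule: list_induct2)
  case Nil
  then show ?case by simp
next
  case (Cons b bs c cs)
  let ?q = "2 ^ length bs :: nat"
  have qubit: "(\<Sum>i<2. cnj (ket_x_qubit b $ i) * ket_x_qubit c $ i) = (if b = c then 1 else 0)"
    by (cases b; cases c) (auto simp: ket_x_qubit_def numeral_2_eq_2 lessThan_Suc simp flip: of_real_mult)
  have dims: "dim_vec (ket_x_qubit a) = 2" for a by (simp add: ket_x_qubit_def)
  have "(\<Sum>i<2 ^ length (b # bs). cnj (ket_x_list (b # bs) $ i) * ket_x_list (c # cs) $ i) =
      (\<Sum>i<2 * ?q. (cnj (ket_x_qubit b $ (i div ?q)) * ket_x_qubit c $ (i div ?q)) *
        (cnj (ket_x_list bs $ (i mod ?q)) * ket_x_list cs $ (i mod ?q)))"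
    using Cons.hyps by (intro sum.cong) (auto simp: kron_vec_def dims dim_ket_x_list)
  also have "\<dots> = (\<Sum>a<2. \<Sum>e<?q. (cnj (ket_x_qubit b $ a) * ket_x_qubit c $ a) *
        (cnj (ket_x_list bs $ e) * ket_x_list cs $ e))"
    by (rule sum_div_mod)
  also have "\<dots> = (\<Sum>a<2. cnj (ket_x_qubit b $ a) * ket_x_qubit c $ a) *
      (\<Sum>e<?q. cnj (ket_x_list bs $ e) * ket_x_list cs $ e)"
    by (simp add: sum_product)
  also have "\<dots> = (if b # bs = c # cs then 1 else 0)"
    unfolding qubit Cons.IH by simp
  finally show ?case .
qed

lemma ket_mat_orthonormal:
  assumes "x \<in> carrier_vec n" "y \<in> carrier_vec n"
  shows "mat_adjoint (ket_mat (ket_x x)) * ket_mat (ket_x y) = (if x = y then 1\<^sub>m 1 else 0\<^sub>m 1 1)"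
proof -
  note c = ket_mat_carrier[OF assms(1)] ket_mat_carrier[OF assms(2)]
  have eq: "list_of_vec x = list_of_vec y \<longleftrightarrow> x = y"
    using assms by (metis vec_list)
  have "(mat_adjoint (ket_mat (ket_x x)) * ket_mat (ket_x y)) $$ (0, 0) =
      (\<Sum>i<2 ^ n. cnj (ket_x x $ i) * ket_x y $ i)"
    using c assms by (subst index_mult_sum[of _ 1 "2 ^ n" _ 1]) (auto simp: ket_mat_def dim_ket_x)
  also have "\<dots> = (if x = y then 1 else 0)"
    using ket_x_list_orthonormal[of "list_of_vec x" "list_of_vec y"] assms by (auto simp: ket_x_def eq)
  finally show ?thesis using c by (intro eq_matI) auto
qed

lemma ket_bra_eq: "ket_bra u = ket_mat u * mat_adjoint (ket_mat u)"
  by (rule eq_matI) (auto simp: ket_bra_def ket_mat_def scalar_prod_def)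

lemma ket_bra_carrier: "x \<in> carrier_vec n \<Longrightarrow> ket_bra (ket_x x) \<in> carrier_mat (2 ^ n) (2 ^ n)"
  by (auto simp: ket_bra_def dim_ket_x)

lemma psd_ket_bra: "x \<in> carrier_vec n \<Longrightarrow> psd (2 ^ n) (ket_bra (ket_x x))"
  using psd_adjoint_mult_self[of "mat_adjoint (ket_mat (ket_x x))" 1 "2 ^ n"] ket_mat_carrier[of x n]
  by (simp add: ket_bra_eq)

lemma tr_ket_bra: "x \<in> carrier_vec n \<Longrightarrow> mat_tr (ket_bra (ket_x x)) = 1"
  using tr_comm[of "ket_mat (ket_x x)" "2 ^ n" 1 "mat_adjoint (ket_mat (ket_x x))"] ket_mat_carrier[of x n]
    ket_mat_orthonormal[of x n x]
  by (simp add: ket_bra_eq mat_tr_def)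

lemma ket_bra_ket:
  assumes "x \<in> carrier_vec n" "y \<in> carrier_vec n"
  shows "ket_bra (ket_x x) * ket_mat (ket_x y) = (if x = y then ket_mat (ket_x x) else 0\<^sub>m (2 ^ n) 1)"
proof -
  note c = ket_mat_carrier[OF assms(1)] ket_mat_carrier[OF assms(2)]
  have "ket_bra (ket_x x) * ket_mat (ket_x y) =
      ket_mat (ket_x x) * (mat_adjoint (ket_mat (ket_x x)) * ket_mat (ket_x y))"
    unfolding ket_bra_eq using c by (intro assoc_mult_mat[of _ "2 ^ n" 1 _ "2 ^ n" _ 1]) auto
  then show ?thesis using c by (simp add: ket_mat_orthonormal[OF assms])
qed

lemma ket_bra_mult:
  assumes "x \<in> carrier_vec n" "y \<in> carrier_vec n"
  shows "ket_bra (ket_x x) * ket_bra (ket_x y) = (if x = y then ket_bra (ket_x x) else 0\<^sub>m (2 ^ n) (2 ^ n))"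
proof -
  note c = ket_mat_carrier[OF assms(1)] ket_mat_carrier[OF assms(2)]
  have "ket_bra (ket_x x) * ket_bra (ket_x y) =
      (ket_bra (ket_x x) * ket_mat (ket_x y)) * mat_adjoint (ket_mat (ket_x y))"
    unfolding ket_bra_eq[of "ket_x y"] using c ket_bra_carrier[OF assms(1)]
    by (intro assoc_mult_mat[of _ "2 ^ n" "2 ^ n" _ 1 _ "2 ^ n", symmetric]) auto
  then show ?thesis
    using c(2) by (simp add: ket_bra_ket[OF assms]) (simp add: ket_bra_eq)
qed

section \<open>Classical-quantum states as block-diagonal operators\<close>

lemma cq_state_carrier: "cq_state n d r \<in> carrier_mat (2 ^ n * d) (2 ^ n * d)"
  by (simp add: cq_state_def)

lemma psd_cq_state:
  assumes "\<And>x. x \<in> carrier_vec n \<Longrightarrow> psd d (r x)"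
  shows "psd (2 ^ n * d) (cq_state n d r)"
  unfolding cq_state_def by (intro psd_mat_sum psd_kron psd_ket_bra assms) auto

lemma tr_cq_state:
  assumes "\<And>x. x \<in> carrier_vec n \<Longrightarrow> r x \<in> carrier_mat d d"
  shows "mat_tr (cq_state n d r) = (\<Sum>x\<in>carrier_vec n. mat_tr (r x))"
  unfolding cq_state_def using assms
  by (subst tr_mat_sum)
    (auto simp: tr_kron[OF ket_bra_carrier assms] tr_ket_bra intro!: sum.cong kron_carrier ket_bra_carrier)

text \<open>Orthonormality of the x basis kills all products of different blocks. Consequently the
  square root of a classical-quantum state is formed block by block.\<close>

lemma cq_state_mult:
  assumes r: "\<And>x. x \<in> carrier_vec n \<Longrightarrow> r x \<in> carrier_mat d d"
    and q: "\<And>x. x \<in> carrier_vec n \<Longrightarrow> q x \<in> carrier_mat d d"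
  shows "cq_state n d r * cq_state n d q = cq_state n d (\<lambda>x. r x * q x)"
proof -
  let ?X = "carrier_vec n :: bit Matrix.vec set" and ?N = "2 ^ n * d"
  let ?k = "\<lambda>x A. kron_mat (ket_bra (ket_x x)) A"
  have kc: "?k x A \<in> carrier_mat ?N ?N" if "x \<in> ?X" "A \<in> carrier_mat d d" for x A
    using that by (intro kron_carrier ket_bra_carrier)
  have absorb: "?k x (r x) * cq_state n d q = ?k x (r x * q x)" if x: "x \<in> ?X" for x
  proof -
    have "?k x (r x) * cq_state n d q = mat_sum ?N ?N (\<lambda>y. ?k x (r x) * ?k y (q y)) ?X"
      unfolding cq_state_def using x r q by (intro mat_sum_mult_left kc) auto
    also have "\<dots> = mat_sum ?N ?N (\<lambda>y. if y = x then ?k x (r x * q x) else 0\<^sub>m ?N ?N) ?X"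
    proof (rule mat_sum_cong)
      fix y assume y: "y \<in> ?X"
      have "?k x (r x) * ?k y (q y) = kron_mat (ket_bra (ket_x x) * ket_bra (ket_x y)) (r x * q y)"
        by (rule kron_mult[OF ket_bra_carrier[OF x] r[OF x] ket_bra_carrier[OF y] q[OF y]])
      then show "?k x (r x) * ?k y (q y) = (if y = x then ?k x (r x * q x) else 0\<^sub>m ?N ?N)"
        using kron_zero_left[OF mult_carrier_mat[OF r[OF x] q[OF y]]]
        by (auto simp: ket_bra_mult[OF x y])
    qed
    also have "\<dots> = ?k x (r x * q x)"
    proof (rule eq_matI)
      have c: "?k x (r x * q x) \<in> carrier_mat ?N ?N" by (intro kc x mult_carrier_mat[OF r q])
      show "mat_sum ?N ?N (\<lambda>y. if y = x then ?k x (r x * q x) else 0\<^sub>m ?N ?N) ?X $$ (i, j) = ?k x (r x * q x) $$ (i, j)"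
        if "i < dim_row (?k x (r x * q x))" "j < dim_col (?k x (r x * q x))" for i j
      proof -
        have ij: "i < ?N" "j < ?N" using that c by auto
        have "(\<Sum>y\<in>?X. (if y = x then ?k x (r x * q x) else 0\<^sub>m ?N ?N) $$ (i, j)) =
            (\<Sum>y\<in>?X. if y = x then ?k x (r x * q x) $$ (i, j) else 0)"
          using ij by (intro sum.cong) auto
        then show ?thesis using ij x by simp
      qed
      show "dim_row (mat_sum ?N ?N (\<lambda>y. if y = x then ?k x (r x * q x) else 0\<^sub>m ?N ?N) ?X) = dim_row (?k x (r x * q x))"
        "dim_col (mat_sum ?N ?N (\<lambda>y. if y = x then ?k x (r x * q x) else 0\<^sub>m ?N ?N) ?X) = dim_col (?k x (r x * q x))"
        using c by auto
    qed
    finally show ?thesis .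
  qed
  have "cq_state n d r * cq_state n d q = mat_sum ?N ?N (\<lambda>x. ?k x (r x) * cq_state n d q) ?X"
    unfolding cq_state_def[of n d r] using r by (intro mat_sum_mult_right cq_state_carrier kc)
  also have "\<dots> = cq_state n d (\<lambda>x. r x * q x)"
    unfolding cq_state_def[of n d "\<lambda>x. r x * q x"] by (intro mat_sum_cong absorb)
  finally show ?thesis .
qed

text \<open>Positivity is assumed of the joint operator, while square roots are needed for each
  block. Compressing with the ket of \<open>x\<close> tensored with the identity on \<open>B\<close>
  extracts the block at \<open>x\<close> and preserves positivity.\<close>

lemma psd_of_psd_cq_state:
  assumes "psd (2 ^ n * d) (cq_state n d r)" and r: "\<And>x. x \<in> carrier_vec n \<Longrightarrow> r x \<in> carrier_mat d d"
    and x: "x \<in> carrier_vec n"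
  shows "psd d (r x)"
proof -
  let ?X = "carrier_vec n :: bit Matrix.vec set" and ?N = "2 ^ n * d"
  let ?k = "\<lambda>x A. kron_mat (ket_bra (ket_x x)) A"
  let ?K = "ket_mat (ket_x x)"
  note Kc = ket_mat_carrier[OF x]
  define W where "W = kron_mat ?K (1\<^sub>m d)"
  have W: "W \<in> carrier_mat ?N d"
    using kron_carrier[OF Kc one_carrier_mat[of d]] by (simp add: W_def)
  have Wa: "mat_adjoint W = kron_mat (mat_adjoint ?K) (1\<^sub>m d)"
    unfolding W_def by (subst adjoint_kron[OF Kc one_carrier_mat]) simp
  have kc: "?k y (r y) \<in> carrier_mat ?N ?N" if "y \<in> ?X" for y
    using that r by (intro kron_carrier ket_bra_carrier)
  have sandwich: "mat_adjoint W * (?k y (r y) * W) = (if y = x then r x else 0\<^sub>m d d)" if y: "y \<in> ?X" for y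
  proof -
    have "?k y (r y) * W = kron_mat (ket_bra (ket_x y) * ?K) (r y)"
      unfolding W_def using r[OF y]
      by (subst kron_mult[OF ket_bra_carrier[OF y] r[OF y] Kc one_carrier_mat]) simp
    then have "mat_adjoint W * (?k y (r y) * W) =
        kron_mat (mat_adjoint ?K * (ket_bra (ket_x y) * ?K)) (r y)"
      unfolding Wa using r[OF y]
        kron_mult[OF adjoint_carrier[OF Kc] one_carrier_mat[of d] mult_carrier_mat[OF ket_bra_carrier[OF y] Kc] r[OF y]]
      by simp
    also have "\<dots> = (if y = x then r x else 0\<^sub>m d d)"
      using kron_zero_left[OF r[OF y], of 1 1] kron_one_left[OF r[OF y]]
        right_mult_zero_mat[OF adjoint_carrier[OF Kc], of 1] ket_mat_orthonormal[OF x x]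
      by (auto simp: ket_bra_ket[OF y x])
    finally show ?thesis .
  qed
  have "mat_adjoint W * cq_state n d r * W = mat_adjoint W * (cq_state n d r * W)"
    by (rule assoc_mult_mat[OF adjoint_carrier[OF W] cq_state_carrier W])
  also have "cq_state n d r * W = mat_sum ?N d (\<lambda>y. ?k y (r y) * W) ?X"
    unfolding cq_state_def by (intro mat_sum_mult_right W kc)
  also have "mat_adjoint W * \<dots> = mat_sum d d (\<lambda>y. mat_adjoint W * (?k y (r y) * W)) ?X"
    by (intro mat_sum_mult_left adjoint_carrier W mult_carrier_mat[OF kc W])
  also have "\<dots> = mat_sum d d (\<lambda>y. if y = x then r x else 0\<^sub>m d d) ?X"
    by (intro mat_sum_cong sandwich)
  also have "\<dots> = r x"
  proof (rule eq_matI)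
    fix i j assume "i < dim_row (r x)" "j < dim_col (r x)"
    then have ij: "i < d" "j < d" using r[OF x] by auto
    have "(\<Sum>y\<in>?X. (if y = x then r x else 0\<^sub>m d d) $$ (i, j)) = (\<Sum>y\<in>?X. if y = x then r x $$ (i, j) else 0)"
      using ij by (intro sum.cong) auto
    then show "mat_sum d d (\<lambda>y. if y = x then r x else 0\<^sub>m d d) ?X $$ (i, j) = r x $$ (i, j)"
      using ij x by simp
  qed (use r[OF x] in auto)
  finally show ?thesis using psd_conj[OF assms(1) W] by simp
qed

text \<open>The witness \<open>\<sigma> = R * R / Tr (R * R)\<close> is the optimal state for the Petz entropy of order 1/2.\<close>

lemma H_max_cq_state_ge:
  assumes r: "\<And>x. x \<in> carrier_vec n \<Longrightarrow> psd d (r x)"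
  defines "R \<equiv> mat_sum d d r (carrier_vec n)"
  assumes pos: "0 < Re (mat_tr (R * R))"
  shows "ereal (log 2 (Re (mat_tr (R * R)))) \<le> H_max (2 ^ n) d (cq_state n d (\<lambda>x. r x * r x))"
proof -
  let ?X = "carrier_vec n :: bit Matrix.vec set" and ?N = "2 ^ n :: nat"
  note rc = psd_carrier[OF r]
  have R: "psd d R" unfolding R_def by (rule psd_mat_sum[OF _ r]) auto
  note Rc = psd_carrier[OF R]
  have RR: "psd d (R * R)" by (rule psd_hermitian_square[OF Rc psd_adjoint[OF R]])
  define t where "t = Re (mat_tr (R * R))"
  have t: "0 < t" using pos by (simp add: t_def)
  have trRR: "mat_tr (R * R) = of_real t" using psd_tr_real[OF RR] by (simp add: t_def)
  \<comment> \<open>\<open>\<tau>\<close> and, below, \<open>I\<close> are the roots of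
    \<open>\<sigma>\<close> and of the maximally mixed state on \<open>A\<close>. Giving them
    explicitly lets uniqueness of roots evaluate every \<open>psd_sqrt\<close> in
    \<open>H_max\<close>.\<close>
  define \<tau> where "\<tau> = complex_of_real (1 / sqrt t) \<cdot>\<^sub>m R"
  define \<sigma> where "\<sigma> = complex_of_real (1 / t) \<cdot>\<^sub>m (R * R)"
  have \<tau>: "psd d \<tau>" unfolding \<tau>_def using t by (intro psd_smult R) auto
  note \<tau>c = psd_carrier[OF \<tau>]
  have \<tau>\<tau>: "\<tau> * \<tau> = \<sigma>"
    unfolding \<tau>_def \<sigma>_def using Rc t
    by (intro eq_matI) (auto simp: square_mat_simps[where n=d] simp flip: of_real_mult)
  have "psd d \<sigma>" unfolding \<sigma>_def using t by (intro psd_smult RR) auto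
  moreover have "mat_tr \<sigma> = 1"
    unfolding \<sigma>_def using psd_carrier[OF RR] t by (simp add: tr_smult[of _ d] trRR)
  ultimately have \<sigma>: "\<sigma> \<in> density_ops d" by (simp add: density_ops_def)
  define I where "I = complex_of_real (1 / sqrt (real ?N)) \<cdot>\<^sub>m 1\<^sub>m ?N"
  have I: "psd ?N I" unfolding I_def by (intro psd_smult psd_one) auto
  note Ic = psd_carrier[OF I]
  have II: "I * I = (1 / of_nat ?N :: complex) \<cdot>\<^sub>m 1\<^sub>m ?N"
    unfolding I_def
    by (intro eq_matI)
      (auto simp: square_mat_simps[where n="?N"] simp flip: of_real_mult)
  have root1: "psd_sqrt (kron_mat ((1 / of_nat ?N :: complex) \<cdot>\<^sub>m 1\<^sub>m ?N) \<sigma>) = kron_mat I \<tau>"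
    unfolding II[symmetric] \<tau>\<tau>[symmetric]
    by (intro psd_sqrt_eqI[of "?N * d"] psd_kron I \<tau> kron_mult[OF Ic \<tau>c Ic \<tau>c])
  have root2: "psd_sqrt (cq_state n d (\<lambda>x. r x * r x)) = cq_state n d r"
    by (intro psd_sqrt_eqI[of "?N * d"] psd_cq_state r cq_state_mult rc)
  define Y where "Y = cq_state n d r * kron_mat I \<tau>"
  have kI: "kron_mat I \<tau> \<in> carrier_mat (?N * d) (?N * d)" by (rule kron_carrier[OF Ic \<tau>c])
  have Y: "Y \<in> carrier_mat (?N * d) (?N * d)"
    unfolding Y_def by (rule mult_carrier_mat[OF cq_state_carrier kI])
  have "mat_tr Y = (\<Sum>x\<in>?X. complex_of_real (1 / sqrt (real ?N)) * mat_tr (r x * \<tau>))"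
  proof -
    have kc: "kron_mat (ket_bra (ket_x x)) (r x) \<in> carrier_mat (?N * d) (?N * d)" if "x \<in> ?X" for x
      using that rc by (intro kron_carrier ket_bra_carrier)
    have "Y = mat_sum (?N * d) (?N * d) (\<lambda>x. kron_mat (ket_bra (ket_x x)) (r x) * kron_mat I \<tau>) ?X"
      unfolding Y_def cq_state_def by (intro mat_sum_mult_right kI kc)
    then have "mat_tr Y = (\<Sum>x\<in>?X. mat_tr (kron_mat (ket_bra (ket_x x)) (r x) * kron_mat I \<tau>))"
      using tr_mat_sum[OF mult_carrier_mat[OF kc kI]] by simp
    also have "\<dots> = (\<Sum>x\<in>?X. complex_of_real (1 / sqrt (real ?N)) * mat_tr (r x * \<tau>))"
    proof (rule sum.cong[OF refl])
      fix x assume x: "x \<in> ?X"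
      have "kron_mat (ket_bra (ket_x x)) (r x) * kron_mat I \<tau> = kron_mat (ket_bra (ket_x x) * I) (r x * \<tau>)"
        by (rule kron_mult[OF ket_bra_carrier[OF x] rc[OF x] Ic \<tau>c])
      moreover have "ket_bra (ket_x x) * I = complex_of_real (1 / sqrt (real ?N)) \<cdot>\<^sub>m ket_bra (ket_x x)"
        unfolding I_def mult_smult_distrib[OF ket_bra_carrier[OF x] one_carrier_mat]
        using ket_bra_carrier[OF x] by simp
      ultimately show "mat_tr (kron_mat (ket_bra (ket_x x)) (r x) * kron_mat I \<tau>) =
          complex_of_real (1 / sqrt (real ?N)) * mat_tr (r x * \<tau>)"
        using tr_kron[OF smult_carrier_mat[OF ket_bra_carrier[OF x]] mult_carrier_mat[OF rc[OF x] \<tau>c]]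
          tr_smult[OF ket_bra_carrier[OF x]] tr_ket_bra[OF x] by simp
    qed
    finally show ?thesis .
  qed
  also have "\<dots> = complex_of_real (1 / sqrt (real ?N)) * mat_tr (R * \<tau>)"
  proof -
    have "R * \<tau> = mat_sum d d (\<lambda>x. r x * \<tau>) ?X"
      unfolding R_def by (intro mat_sum_mult_right \<tau>c rc)
    then have "mat_tr (R * \<tau>) = (\<Sum>x\<in>?X. mat_tr (r x * \<tau>))"
      using tr_mat_sum[OF mult_carrier_mat[OF rc \<tau>c]] by simp
    then show ?thesis by (simp add: sum_distrib_left)
  qed
  also have "mat_tr (R * \<tau>) = of_real (1 / sqrt t) * of_real t"
    unfolding \<tau>_def mult_smult_distrib[OF Rc Rc] tr_smult[OF mult_carrier_mat[OF Rc Rc]] trRR ..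
  also have "of_real (1 / sqrt t) * complex_of_real t = of_real (sqrt t)"
    unfolding of_real_mult[symmetric] using t by (simp add: real_div_sqrt)
  finally have "Re (mat_tr Y) = sqrt t / sqrt (real ?N)" by (simp flip: of_real_mult of_real_power)
  \<comment> \<open>Squaring this and multiplying by the factor \<open>2 ^ n\<close> in
    \<open>H_max\<close> removes the normalisation of \<open>I\<close> and leaves exactly
    \<open>t\<close>.\<close>
  then have "sqrt t / sqrt (real ?N) \<le> trace_norm Y" using Re_tr_le_trace_norm[OF Y] by simp
  then have "(sqrt t / sqrt (real ?N))\<^sup>2 \<le> (trace_norm Y)\<^sup>2"
    using t by (intro power_mono) auto
  then have "t \<le> real ?N * (trace_norm Y)\<^sup>2"
    using t by (simp add: power_divide field_simps)
  then have "ereal (log 2 t) \<le> log2_ereal (real ?N * (trace_norm Y)\<^sup>2)"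
    using t by (simp add: log2_ereal_def)
  then show ?thesis
    unfolding H_max_def t_def[symmetric]
    by (intro SUP_upper2[OF \<sigma>]) (simp add: root1[simplified] root2 Y_def)
qed

text \<open>Here \<open>h\<close> is an extended real: at plus infinity the bound is trivial, and
  minus infinity contradicts the hypothesis.\<close>

lemma exp2_ereal_ge:
  assumes "0 < t" "ereal (log 2 t) \<le> h"
  shows "ereal (t / 2 ^ k) \<le> exp2_ereal (h - ereal (real k))"
proof (cases h)
  case (real h')
  then have "log 2 t \<le> h'" using assms(2) by simp
  then have "t \<le> 2 powr h'" using assms(1) by (simp add: log_le_iff)
  then show ?thesis
    using real by (simp add: exp2_ereal_def powr_diff powr_realpow divide_right_mono)
qed (use assms in \<open>auto simp: exp2_ereal_def\<close>)

lemma exp2_ereal_nonneg: "0 \<le> exp2_ereal h"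
  by (auto simp: exp2_ereal_def)

section \<open>Fourier analysis on bit strings\<close>

text \<open>The nontrivial additive character of the two-element field, with real values.\<close>

definition bit_sign :: "bit \<Rightarrow> real" where
  "bit_sign b = (if b = 0 then 1 else - 1)"

lemma bit_sign_add: "bit_sign (a + b) = bit_sign a * bit_sign b"
  by (cases a; cases b) (auto simp: bit_sign_def)

lemma bit_sign_mult_self [simp]: "bit_sign a * bit_sign a = 1"
  by (auto simp: bit_sign_def)

lemma bit_sign_0 [simp]: "bit_sign 0 = 1" and bit_sign_1 [simp]: "bit_sign 1 = - 1"
  by (auto simp: bit_sign_def)

lemma card_bit_vec: "card (carrier_vec n :: bit Matrix.vec set) = 2 ^ n"
proof -
  have UNIV: "(UNIV :: bit set) = {0, 1}" using bit_not_zero_iff by blast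
  have U: "finite (UNIV :: bit set)" "card (UNIV :: bit set) = 2" unfolding UNIV by simp_all
  have "bij_betw list_of_vec (carrier_vec n) {xs :: bit list. set xs \<subseteq> UNIV \<and> length xs = n}"
    by (rule bij_betw_byWitness[where f'=vec_of_list]) (auto simp: list_vec vec_list intro!: carrier_vecI)
  from bij_betw_same_card[OF this]
  show ?thesis using card_lists_length_eq[OF U(1), of n] U(2) by simp
qed

text \<open>Orthogonality of characters: if \<open>u\<close> has a nonzero entry at
  \<open>i\<close>, translating the summation variable by the \<open>i\<close>-th unit vector flips
  every sign, so the sum equals its own negative.\<close>

lemma sum_bit_sign:
  fixes u :: "bit Matrix.vec"
  assumes u: "u \<in> carrier_vec n"
  shows "(\<Sum>w\<in>carrier_vec n. bit_sign (w \<bullet> u)) = (if u = 0\<^sub>v n then 2 ^ n else 0)"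
proof (cases "u = 0\<^sub>v n")
  case True
  then show ?thesis by (simp add: card_bit_vec)
next
  case False
  then obtain i where i: "i < n" "u $ i = 1"
    using u by (auto simp: vec_eq_iff)
  let ?e = "unit_vec n i :: bit Matrix.vec"
  have ee: "?e + ?e = 0\<^sub>v n" by (simp add: bit_vec_add_eq_0_iff)
  have "(\<Sum>w\<in>carrier_vec n. bit_sign (w \<bullet> u)) = (\<Sum>w\<in>carrier_vec n. bit_sign ((w + ?e) \<bullet> u))"
    by (rule sum.reindex_bij_witness[where i="\<lambda>w. w + ?e" and j="\<lambda>w. w + ?e"]) (auto simp: ee)
  also have "\<dots> = (\<Sum>w\<in>carrier_vec n. - bit_sign (w \<bullet> u))"
    using u i by (intro sum.cong) (auto simp: add_scalar_prod_distrib[of _ n] bit_sign_add)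
  finally show ?thesis using False by (simp add: sum_negf)
qed

text \<open>The diagonal of the two-variable Fourier transform of the kernel \<open>\<tau>\<close>,
  without normalisation. Keeping \<open>\<tau>\<close> arbitrary separates the identities on bit
  strings from the operators.\<close>

definition fourier_weight :: "nat \<Rightarrow> (bit Matrix.vec \<Rightarrow> bit Matrix.vec \<Rightarrow> real) \<Rightarrow> bit Matrix.vec \<Rightarrow> real" where
  "fourier_weight n \<tau> z =
    (\<Sum>x\<in>carrier_vec n. \<Sum>y\<in>carrier_vec n. bit_sign (z \<bullet> x) * bit_sign (z \<bullet> y) * \<tau> x y)"

text \<open>Poisson summation, with the row space parametrised by \<open>w\<close>. Moving the
  transpose across the scalar product turns the two characters into one evaluated at
  \<open>g *\<^sub>v x + g *\<^sub>v y\<close>, and summing over \<open>w\<close> tests whether this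
  vector is zero.\<close>

lemma sum_fourier_weight_range:
  assumes g: "g \<in> carrier_mat k n"
  shows "(\<Sum>w\<in>carrier_vec k. fourier_weight n \<tau> (transpose_mat g *\<^sub>v w)) =
    2 ^ k * (\<Sum>x\<in>carrier_vec n. \<Sum>y\<in>carrier_vec n. if g *\<^sub>v x = g *\<^sub>v y then \<tau> x y else 0)"
proof -
  let ?X = "carrier_vec n :: bit Matrix.vec set" and ?W = "carrier_vec k :: bit Matrix.vec set"
  have "(\<Sum>w\<in>?W. bit_sign ((transpose_mat g *\<^sub>v w) \<bullet> x) * bit_sign ((transpose_mat g *\<^sub>v w) \<bullet> y) * \<tau> x y) =
      2 ^ k * (if g *\<^sub>v x = g *\<^sub>v y then \<tau> x y else 0)" if "x \<in> ?X" "y \<in> ?X" for x y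
  proof -
    have gx: "g *\<^sub>v x \<in> ?W" "g *\<^sub>v y \<in> ?W" using g that by auto
    have "(\<Sum>w\<in>?W. bit_sign ((transpose_mat g *\<^sub>v w) \<bullet> x) * bit_sign ((transpose_mat g *\<^sub>v w) \<bullet> y) * \<tau> x y) =
        (\<Sum>w\<in>?W. bit_sign (w \<bullet> (g *\<^sub>v x + g *\<^sub>v y))) * \<tau> x y"
      unfolding sum_distrib_right using gx that
      by (intro sum.cong)
        (auto simp: transpose_vec_mult_scalar[OF g] scalar_prod_add_distrib[of _ k] bit_sign_add)
    also have "\<dots> = 2 ^ k * (if g *\<^sub>v x = g *\<^sub>v y then \<tau> x y else 0)"
      using gx by (auto simp: sum_bit_sign bit_vec_add_eq_0_iff)
    finally show ?thesis .
  qed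
  then have "(\<Sum>x\<in>?X. \<Sum>y\<in>?X. \<Sum>w\<in>?W. bit_sign ((transpose_mat g *\<^sub>v w) \<bullet> x) * bit_sign ((transpose_mat g *\<^sub>v w) \<bullet> y) * \<tau> x y) =
      2 ^ k * (\<Sum>x\<in>?X. \<Sum>y\<in>?X. if g *\<^sub>v x = g *\<^sub>v y then \<tau> x y else 0)"
    by (simp add: sum_distrib_left)
  moreover have "(\<Sum>w\<in>?W. \<Sum>x\<in>?X. \<Sum>y\<in>?X. F w x y) = (\<Sum>x\<in>?X. \<Sum>y\<in>?X. \<Sum>w\<in>?W. F w x y)"
    for F :: "bit Matrix.vec \<Rightarrow> bit Matrix.vec \<Rightarrow> bit Matrix.vec \<Rightarrow> real"
    by (subst sum.swap) (intro sum.cong refl sum.swap)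
  ultimately show ?thesis unfolding fourier_weight_def by simp
qed

text \<open>Parseval's identity, obtained as the case of the identity matrix, whose only collisions
  are \<open>x = y\<close>.\<close>

lemma sum_fourier_weight:
  "(\<Sum>z\<in>carrier_vec n. fourier_weight n \<tau> z) = 2 ^ n * (\<Sum>x\<in>carrier_vec n. \<tau> x x)"
proof -
  have "(\<Sum>z\<in>carrier_vec n. fourier_weight n \<tau> z) =
      (\<Sum>w\<in>carrier_vec n. fourier_weight n \<tau> (transpose_mat (1\<^sub>m n) *\<^sub>v w))"
    by (intro sum.cong) auto
  also have "\<dots> = 2 ^ n * (\<Sum>x\<in>carrier_vec n. \<Sum>y\<in>carrier_vec n. if x = y then \<tau> x y else 0)"
    unfolding sum_fourier_weight_range[OF one_carrier_mat] by (auto intro!: sum.cong)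
  finally show ?thesis by simp
qed

lemma fourier_weight_zero:
  "fourier_weight n \<tau> (0\<^sub>v n) = (\<Sum>x\<in>carrier_vec n. \<Sum>y\<in>carrier_vec n. \<tau> x y)"
  unfolding fourier_weight_def by (auto intro!: sum.cong)

text \<open>A vector killed by the transpose is orthogonal to all columns of \<open>g\<close>, and
  these span the space because the rank is \<open>k\<close>. The scalar product is bilinear over an
  arbitrary field and may vanish on nonzero \<open>(w, w)\<close>, so \<open>w\<close> is paired
  with unit vectors rather than with itself.\<close>

lemma full_row_rank_transpose_kernel:
  fixes g :: "'a :: field mat"
  assumes g: "g \<in> carrier_mat k n" and rank: "vec_space.rank k g = k"
    and w: "w \<in> carrier_vec k" and 0: "transpose_mat g *\<^sub>v w = 0\<^sub>v n"
  shows "w = 0\<^sub>v k"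
proof -
  interpret vec_space "TYPE('a)" k .
  have orth: "w \<bullet> c = 0" if c: "c \<in> set (cols g)" for c
  proof -
    obtain j where j: "j < n" "c = col g j"
      using c g by (metis carrier_matD(2) cols_length cols_nth in_set_conv_nth)
    have "(transpose_mat g *\<^sub>v w) $ j = col g j \<bullet> w" using g j by simp
    then have "col g j \<bullet> w = 0" using 0 j by simp
    then show ?thesis
      using comm_scalar_prod[OF w, of "col g j"] col_dim[of g j] g j by auto
  qed
  have "lin_indpt {}" by (intro finite_lin_indpt2) auto
  \<comment> \<open>A maximal independent set of columns has as many elements as the rank, namely
    \<open>k\<close>, and is therefore a basis.\<close>
  then obtain S where S: "maximal S (\<lambda>T. T \<subseteq> set (cols g) \<and> lin_indpt T)" "finite S"
    using maximal_exists_superset[of "set (cols g)" "\<lambda>T. T \<subseteq> set (cols g) \<and> lin_indpt T" "{}"] by auto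
  then have SC: "S \<subseteq> set (cols g)" "lin_indpt S" "card S = k"
    using rank_card_indpt[OF g S(1)] rank by (auto simp: maximal_def)
  have Sc: "S \<subseteq> carrier_vec k" using SC(1) cols_dim[of g] g by auto
  have "basis S"
    using dim_li_is_basis[OF fin_dim S(2) _ SC(2)] Sc SC(3) dim_is_n by auto
  then have span: "span S = carrier_vec k" 
    unfolding basis_def module_vec_simps by (elim conjE)
  have "w $ i = 0" if i: "i < k" for i
  proof -
    have "unit_vec k i \<in> span S" unfolding span by simp
    then obtain a A where A: "unit_vec k i = lincomb a A" "finite A" "A \<subseteq> S"
      using in_spanE by blast
    have Ac: "A \<subseteq> carrier_vec k" using A(3) Sc by auto
    have "w $ i = w \<bullet> unit_vec k i" using w i by simp
    also have "\<dots> = (\<Sum>j<k. \<Sum>c\<in>A. a c * (w $ j * c $ j))"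
      unfolding A(1) using Ac w
      by (auto simp: scalar_prod_def atLeast0LessThan lincomb_index sum_distrib_left mult_ac
          lincomb_dim[OF A(2)] intro!: sum.cong)
    also have "\<dots> = (\<Sum>c\<in>A. a c * (w \<bullet> c))"
      using Ac by (subst sum.swap)
        (auto simp: scalar_prod_def atLeast0LessThan sum_distrib_left intro!: sum.cong)
    also have "\<dots> = 0" using orth A(3) SC(1) by (intro sum.neutral) auto
    finally show ?thesis .
  qed
  then show ?thesis using w by (intro eq_vecI) auto
qed

text \<open>Full rank of \<open>g\<close> makes \<open>w\<close> a faithful parameter of the row
  space, so no weight is repeated. Orthogonality places the row space inside the kernel of
  \<open>f\<close>, and nonnegative weights allow the sum to be extended to that kernel.\<close>

lemma sum_fourier_weight_dual:
  assumes fg: "dual_functions n m f g"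
    and nonneg: "\<And>z. z \<in> carrier_vec n \<Longrightarrow> 0 \<le> fourier_weight n \<tau> z"
  shows "(\<Sum>w\<in>carrier_vec (n - m). fourier_weight n \<tau> (transpose_mat g *\<^sub>v w)) \<le>
    fourier_weight n \<tau> (0\<^sub>v n) +
    (\<Sum>z\<in>carrier_vec n - {0\<^sub>v n}. if f *\<^sub>v z = 0\<^sub>v m then fourier_weight n \<tau> z else 0)"
proof -
  let ?W = "carrier_vec (n - m) :: bit Matrix.vec set"
  let ?K = "{z \<in> carrier_vec n. f *\<^sub>v z = 0\<^sub>v m}"
  have f: "f \<in> carrier_mat m n" and g: "g \<in> carrier_mat (n - m) n" and rg: "full_rank (n - m) n g"
    and 0: "f * transpose_mat g = 0\<^sub>m m (n - m)"
    using fg by (auto simp: dual_functions_def full_rank_def)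
  have inj: "inj_on (\<lambda>w. transpose_mat g *\<^sub>v w) ?W"
  proof (rule inj_onI)
    fix w v assume wv: "w \<in> ?W" "v \<in> ?W" "transpose_mat g *\<^sub>v w = transpose_mat g *\<^sub>v v"
    then have "transpose_mat g *\<^sub>v (w + v) = 0\<^sub>v n"
      using g by (subst mult_add_distrib_mat_vec[of _ n "n - m"])
        (auto simp: bit_vec_add_eq_0_iff[of _ n])
    then have "w + v = 0\<^sub>v (n - m)"
      using full_row_rank_transpose_kernel[of g "n - m" n "w + v"] rg wv by (simp add: full_rank_def)
    then show "w = v" using bit_vec_add_eq_0_iff wv by metis
  qed
  have sub: "(\<lambda>w. transpose_mat g *\<^sub>v w) ` ?W \<subseteq> ?K"
  proof safe
    fix w :: "bit Matrix.vec" assume w: "w \<in> ?W"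
    show "transpose_mat g *\<^sub>v w \<in> carrier_vec n" using g w by auto
    have "f *\<^sub>v (transpose_mat g *\<^sub>v w) = (f * transpose_mat g) *\<^sub>v w"
      using f g w by (subst assoc_mult_mat_vec[of _ m n _ "n - m"]) auto
    then show "f *\<^sub>v (transpose_mat g *\<^sub>v w) = 0\<^sub>v m" unfolding 0 using w by auto
  qed
  have "(\<Sum>w\<in>?W. fourier_weight n \<tau> (transpose_mat g *\<^sub>v w)) =
      (\<Sum>z\<in>(\<lambda>w. transpose_mat g *\<^sub>v w) ` ?W. fourier_weight n \<tau> z)"
    by (simp add: sum.reindex[OF inj])
  also have "\<dots> \<le> (\<Sum>z\<in>?K. fourier_weight n \<tau> z)"
    using sub by (intro sum_mono2) (auto intro: nonneg)
  also have "\<dots> = (\<Sum>z\<in>carrier_vec n. if f *\<^sub>v z = 0\<^sub>v m then fourier_weight n \<tau> z else 0)"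
    by (simp add: sum.inter_filter)
  also have "\<dots> = fourier_weight n \<tau> (0\<^sub>v n) +
      (\<Sum>z\<in>carrier_vec n - {0\<^sub>v n}. if f *\<^sub>v z = 0\<^sub>v m then fourier_weight n \<tau> z else 0)"
    using f by (subst sum.remove[of _ "0\<^sub>v n"]) auto
  finally show ?thesis .
qed

section \<open>The average over a dual universal family\<close>

text \<open>The weight is \<open>Tr (H * H)\<close> for the Hermitian matrix \<open>H\<close> that
  adds the \<open>r x\<close> with the signs of the character at \<open>z\<close>.\<close>

lemma fourier_weight_overlap_nonneg:
  assumes r: "\<And>x. x \<in> carrier_vec n \<Longrightarrow> psd d (r x)"
  shows "0 \<le> fourier_weight n (\<lambda>x y. Re (mat_tr (r x * r y))) z"
proof -
  let ?X = "carrier_vec n :: bit Matrix.vec set"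
  note rc = psd_carrier[OF r]
  define s where "s x = complex_of_real (bit_sign (z \<bullet> x)) \<cdot>\<^sub>m r x" for x
  have s: "s x \<in> carrier_mat d d" "mat_adjoint (s x) = s x" if "x \<in> ?X" for x
    using rc[OF that] psd_adjoint[OF r[OF that]] by (auto simp: s_def)
  define H where "H = mat_sum d d s ?X"
  have H: "H \<in> carrier_mat d d" "mat_adjoint H = H"
  proof -
    have "mat_adjoint H = mat_sum d d (\<lambda>x. mat_adjoint (s x)) ?X"
      unfolding H_def using s(1) by (rule adjoint_mat_sum)
    also have "\<dots> = H" unfolding H_def by (intro mat_sum_cong s(2))
    finally show "mat_adjoint H = H" .
  qed (simp add: H_def)
  have "mat_tr (s x * s y) = of_real (bit_sign (z \<bullet> x) * bit_sign (z \<bullet> y)) * mat_tr (r x * r y)"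
    if "x \<in> ?X" "y \<in> ?X" for x y
    using rc[OF that(1)] rc[OF that(2)] by (simp add: s_def square_mat_simps[where n=d])
  then have "fourier_weight n (\<lambda>x y. Re (mat_tr (r x * r y))) z = Re (mat_tr (H * H))"
    unfolding fourier_weight_def H_def using s(1) by (simp add: tr_mat_sum_mult)
  then show ?thesis using psd_tr_nonneg[OF psd_hermitian_square[OF H]] by simp
qed

text \<open>Only \<open>of_bool\<close> terms on the right depend on \<open>f\<close>, so averaging
  will turn each of them into the probability that \<open>f\<close> kills \<open>z\<close>.\<close>

lemma Q_DC_dual_le:
  assumes r: "\<And>x. x \<in> carrier_vec n \<Longrightarrow> psd d (r x)" and fg: "dual_functions n m f g"
  defines "\<tau> \<equiv> \<lambda>x y. Re (mat_tr (r x * r y))"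
  shows "Q_DC n (n - m) d (\<lambda>x. g *\<^sub>v x) (\<lambda>x. r x * r x) \<le>
    ((\<Sum>x\<in>carrier_vec n. \<Sum>y\<in>carrier_vec n. \<tau> x y) +
      (\<Sum>z\<in>carrier_vec n - {0\<^sub>v n}. of_bool (f *\<^sub>v z = 0\<^sub>v m) * fourier_weight n \<tau> z)) / 2 ^ (n - m)
    - (\<Sum>x\<in>carrier_vec n. \<tau> x x)"
proof -
  have g: "g \<in> carrier_mat (n - m) n"
    using fg by (auto simp: dual_functions_def full_rank_def)
  have "2 ^ (n - m) * (\<Sum>x\<in>carrier_vec n. \<Sum>y\<in>carrier_vec n. if g *\<^sub>v x = g *\<^sub>v y then \<tau> x y else 0) \<le>
      fourier_weight n \<tau> (0\<^sub>v n) +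
      (\<Sum>z\<in>carrier_vec n - {0\<^sub>v n}. if f *\<^sub>v z = 0\<^sub>v m then fourier_weight n \<tau> z else 0)"
    unfolding sum_fourier_weight_range[OF g, symmetric]
    by (intro sum_fourier_weight_dual[OF fg]) (unfold \<tau>_def, rule fourier_weight_overlap_nonneg[OF r])
  also have "\<dots> = (\<Sum>x\<in>carrier_vec n. \<Sum>y\<in>carrier_vec n. \<tau> x y) +
      (\<Sum>z\<in>carrier_vec n - {0\<^sub>v n}. of_bool (f *\<^sub>v z = 0\<^sub>v m) * fourier_weight n \<tau> z)"
    unfolding fourier_weight_zero by (intro arg_cong2[where f="(+)"] sum.cong refl) auto
  finally have "(\<Sum>x\<in>carrier_vec n. \<Sum>y\<in>carrier_vec n. if g *\<^sub>v x = g *\<^sub>v y then \<tau> x y else 0) \<le>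
    ((\<Sum>x\<in>carrier_vec n. \<Sum>y\<in>carrier_vec n. \<tau> x y) +
      (\<Sum>z\<in>carrier_vec n - {0\<^sub>v n}. of_bool (f *\<^sub>v z = 0\<^sub>v m) * fourier_weight n \<tau> z)) / 2 ^ (n - m)"
    by (simp add: pos_le_divide_eq mult.commute)
  moreover have "Q_DC n (n - m) d (\<lambda>x. g *\<^sub>v x) (\<lambda>x. r x * r x) \<le>
      (\<Sum>x\<in>carrier_vec n. \<Sum>y\<in>carrier_vec n. if g *\<^sub>v x = g *\<^sub>v y then \<tau> x y else 0)
      - (\<Sum>x\<in>carrier_vec n. \<tau> x x)"
    unfolding \<tau>_def using g by (intro Q_DC_le r) auto
  ultimately show ?thesis by linarith
qed

lemma pmf_prob_sum:
  assumes "finite S" "set_pmf F \<subseteq> S"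
  shows "(\<Sum>f\<in>S. pmf F f * of_bool (P f)) = measure_pmf.prob F {f. P f}"
proof -
  have "measure_pmf.prob F {f. P f} = measure_pmf.expectation F (indicat_real {f. P f})"
    by simp
  also have "\<dots> = (\<Sum>f\<in>S. pmf F f *\<^sub>R indicat_real {f. P f} f)"
    using assms by (intro integral_measure_pmf) auto
  finally show ?thesis by (simp add: indicator_def)
qed

lemma expectation_Q_DC_le:
  assumes "m \<le> n" "0 \<le> \<delta>" and dual: "dual_random_functions n m F G"
    and univ: "almost_universal2 \<delta> n m F" and r: "\<And>x. x \<in> carrier_vec n \<Longrightarrow> psd d (r x)"
  defines "R \<equiv> mat_sum d d r (carrier_vec n)"
  shows "measure_pmf.expectation G (\<lambda>g. Q_DC n (n - m) d (\<lambda>x. g *\<^sub>v x) (\<lambda>x. r x * r x)) \<le>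
    (\<delta> - 1) * (\<Sum>x\<in>carrier_vec n. Re (mat_tr (r x * r x))) + Re (mat_tr (R * R)) / 2 ^ (n - m)"
proof -
  let ?X = "carrier_vec n :: bit Matrix.vec set"
  define Q where "Q g = Q_DC n (n - m) d (\<lambda>x. g *\<^sub>v x) (\<lambda>x. r x * r x)" for g
  define \<tau> where "\<tau> x y = Re (mat_tr (r x * r y))" for x y
  define q where "q = fourier_weight n \<tau>"
  define p where "p = (\<Sum>x\<in>?X. \<tau> x x)"
  define t where "t = (\<Sum>x\<in>?X. \<Sum>y\<in>?X. \<tau> x y)"
  have tR: "t = Re (mat_tr (R * R))"
    unfolding t_def \<tau>_def R_def using psd_carrier[OF r] by (simp add: tr_mat_sum_mult)
  have q0: "0 \<le> q z" for z
    unfolding q_def \<tau>_def by (rule fourier_weight_overlap_nonneg[OF r])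
  obtain S T \<phi> where ST: "finite S" "finite T" "set_pmf F \<subseteq> S" "set_pmf G \<subseteq> T" "bij_betw \<phi> S T"
    and \<phi>: "\<And>f. f \<in> S \<Longrightarrow> dual_functions n m f (\<phi> f)" "\<And>f. f \<in> S \<Longrightarrow> pmf F f = pmf G (\<phi> f)"
    using dual unfolding dual_random_functions_def by blast
  define w where "w f = (\<Sum>z\<in>?X - {0\<^sub>v n}. of_bool (f *\<^sub>v z = 0\<^sub>v m) * q z)" for f
  have "measure_pmf.expectation G Q = (\<Sum>g\<in>T. pmf G g * Q g)"
    using ST(2,4) by (subst integral_measure_pmf[of T]) auto
  \<comment> \<open>The pairing \<open>\<phi>\<close> preserves probabilities, so the average over
    \<open>G\<close> becomes one over \<open>F\<close>, for which universality is assumed.\<close>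
  also have "\<dots> = (\<Sum>f\<in>S. pmf F f * Q (\<phi> f))"
    using \<phi>(2) by (simp add: sum.reindex_bij_betw[OF ST(5), symmetric])
  also have "\<dots> \<le> (\<Sum>f\<in>S. pmf F f * ((t + w f) / 2 ^ (n - m) - p))"
  proof (intro sum_mono mult_left_mono pmf_nonneg)
    fix f assume "f \<in> S"
    then show "Q (\<phi> f) \<le> (t + w f) / 2 ^ (n - m) - p"
      unfolding Q_def t_def w_def q_def p_def \<tau>_def by (intro Q_DC_dual_le r \<phi>(1))
  qed
  also have "\<dots> = (\<Sum>f\<in>S. pmf F f) * (t / 2 ^ (n - m) - p) + (\<Sum>f\<in>S. pmf F f * w f) / 2 ^ (n - m)"
    unfolding sum_distrib_right sum_divide_distrib sum.distrib[symmetric]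
    by (intro sum.cong refl) (simp add: algebra_simps add_divide_distrib)
  also have "(\<Sum>f\<in>S. pmf F f) = 1"
    using ST(1,3) by (rule sum_pmf_eq_1)
  also have "(\<Sum>f\<in>S. pmf F f * w f) = (\<Sum>z\<in>?X - {0\<^sub>v n}. measure_pmf.prob F {f. f *\<^sub>v z = 0\<^sub>v m} * q z)"
    unfolding w_def sum_distrib_left pmf_prob_sum[OF ST(1,3), symmetric] sum_distrib_right
    by (subst sum.swap) (simp add: mult_ac)
  also have "\<dots> \<le> (\<Sum>z\<in>?X - {0\<^sub>v n}. 2 powr (- real m) * \<delta> * q z)"
    using univ q0 by (intro sum_mono mult_right_mono) (auto simp: almost_universal2_def)
  \<comment> \<open>The weight at zero is added back so that Parseval evaluates the sum; since
    \<open>0 \<le> \<delta>\<close>, the added term is nonnegative.\<close>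
  also have "\<dots> \<le> (\<Sum>z\<in>?X. 2 powr (- real m) * \<delta> * q z)"
    using q0 assms(2) by (intro sum_mono2) auto
  also have "\<dots> = 2 powr (- real m) * \<delta> * (2 ^ n * p)"
    unfolding sum_distrib_left[symmetric] q_def p_def sum_fourier_weight ..
  \<comment> \<open>This power of two cancels the factor from Poisson summation and leaves
    \<open>\<delta>\<close> times the trace.\<close>
  also have "\<dots> = 2 ^ (n - m) * (\<delta> * p)"
    using assms(1) by (simp add: powr_minus powr_realpow power_diff field_simps)
  finally have "measure_pmf.expectation G Q \<le> 1 * (t / 2 ^ (n - m) - p) + 2 ^ (n - m) * (\<delta> * p) / 2 ^ (n - m)"
    by (simp add: divide_right_mono)
  then show ?thesis
    unfolding Q_def[symmetric] tR[symmetric] p_def[symmetric] \<tau>_def[symmetric]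
    by (simp add: algebra_simps)
qed

theorem lemma7:
  fixes n m d :: nat and \<delta> :: real
    and F G :: "bit mat pmf"
    and \<rho> :: "complex mat" and \<rho>x :: "bit Matrix.vec \<Rightarrow> complex mat"
  assumes "m \<le> n" and "0 \<le> \<delta>"
    and "dual_random_functions n m F G"
    and "almost_universal2 \<delta> n m F"
    and "\<And>x. x \<in> carrier_vec n \<Longrightarrow> \<rho>x x \<in> carrier_mat d d"
    and "\<rho> = cq_state n d \<rho>x"
    and "subnormalized (2 ^ n * d) \<rho>"
  shows "measure_pmf.expectation G (\<lambda>g. Q_EC n (n - m) d (\<lambda>x. g *\<^sub>v x) \<rho>x)
           = measure_pmf.expectation G (\<lambda>g. Q_DC n (n - m) d (\<lambda>x. g *\<^sub>v x) \<rho>x)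
       \<and> ereal (measure_pmf.expectation G (\<lambda>g. Q_DC n (n - m) d (\<lambda>x. g *\<^sub>v x) \<rho>x))
           \<le> ereal ((\<delta> - 1) * Re (mat_tr \<rho>)) + exp2_ereal (H_max (2 ^ n) d \<rho> - ereal (real (n - m)))"
proof -
  let ?X = "carrier_vec n :: bit Matrix.vec set"
  define r where "r x = psd_sqrt (\<rho>x x)" for x
  have \<rho>x: "psd d (\<rho>x x)" if "x \<in> ?X" for x
    using psd_of_psd_cq_state[of n d \<rho>x, OF _ assms(5) that] assms(6,7)
    by (auto simp: subnormalized_def)
  have r: "psd d (r x)" "r x * r x = \<rho>x x" if "x \<in> ?X" for x
    using psd_psd_sqrt psd_sqrt_mult_self \<rho>x[OF that] by (auto simp: r_def)
  have cq: "\<rho> = cq_state n d (\<lambda>x. r x * r x)"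
    unfolding assms(6) cq_state_def using r(2) by (intro mat_sum_cong) simp
  have DC: "Q_DC n (n - m) d h \<rho>x = Q_DC n (n - m) d h (\<lambda>x. r x * r x)" for h
    unfolding Q_DC_def using r(2) by (intro INF_cong sum.cong refl) simp
  have tr: "Re (mat_tr \<rho>) = (\<Sum>x\<in>?X. Re (mat_tr (r x * r x)))"
    unfolding assms(6) using r(2) by (simp add: tr_cq_state assms(5))
  define t where "t = Re (mat_tr (mat_sum d d r ?X * mat_sum d d r ?X))"
  have mono: "ereal e \<le> ereal a + h" if "ereal c \<le> h" "e \<le> a + c" for e a c h
    using that by (cases h) auto
  have "ereal (t / 2 ^ (n - m)) \<le> exp2_ereal (H_max (2 ^ n) d \<rho> - ereal (real (n - m)))"
  \<comment> \<open>The logarithm of \<open>t\<close> is available only for positive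
    \<open>t\<close>. Otherwise nonnegativity of \<open>exp2_ereal\<close> suffices; this includes
    \<open>d = 0\<close>, where the supremum in \<open>H_max\<close> is over the empty set.\<close>
  proof (cases "0 < t")
    case True
    then show ?thesis
      unfolding cq using H_max_cq_state_ge[of n d r, OF r(1)] by (intro exp2_ereal_ge) (auto simp: t_def)
  next
    case False
    then have "ereal (t / 2 ^ (n - m)) \<le> 0" by (simp add: divide_nonpos_nonneg)
    then show ?thesis using exp2_ereal_nonneg by (rule order_trans)
  qed
  moreover have "measure_pmf.expectation G (\<lambda>g. Q_DC n (n - m) d (\<lambda>x. g *\<^sub>v x) \<rho>x) \<le>
      (\<delta> - 1) * Re (mat_tr \<rho>) + t / 2 ^ (n - m)"
    unfolding DC tr t_def using expectation_Q_DC_le[OF assms(1-4) r(1)] by simp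
  ultimately have "ereal (measure_pmf.expectation G (\<lambda>g. Q_DC n (n - m) d (\<lambda>x. g *\<^sub>v x) \<rho>x)) \<le>
      ereal ((\<delta> - 1) * Re (mat_tr \<rho>)) + exp2_ereal (H_max (2 ^ n) d \<rho> - ereal (real (n - m)))"
    by (rule mono)
  then show ?thesis by (simp add: Q_EC_eq_Q_DC)
qed

end
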